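(* Let $X$ be a zero-dimensional analytic separable metrizable space. Then $X$ is $\sigma$-homogeneous with analytic witnesses, that is, there exist homogeneous subspaces $X_n$ of $X$ for $n\in\omega$ such that $X=\bigcup_{n\in\omega}X_n$ and $X_n\in\mathbf{\Sigma}^1_1(X)$ for each $n$.
   Context: The base theory is $\mathsf{ZF}+\mathsf{DC}$ (Zermelo-Fraenkel set theory without the Axiom of Choice, plus Dependent Choices). All spaces are separable and metrizable. A space is zero-dimensional if it has a base of clopen sets. A space $X$ is homogeneous if for every $(x,y)\in X\times X$ there is a homeomorphism $h:X\to X$ with $h(x)=y$. An embedding $j:X\to Z$ is a function that is a homeomorphism onto its image $j[X]$. For an arbitrary space $X$ and $A\subseteq X$, declare $A\in\mathbf{\Sigma}^1_1(X)$ if there exist a Polish space $Z$, an embedding $j:X\to Z$ and $\widetilde{A}\in\mathbf{\Sigma}^1_1(Z)$ (i.e. an analytic subset of $Z$) such that $j[A]=\widetilde{A}\cap j[X]$. A space $X$ is analytic if there exist a Polish space $Z$ and an embedding $j:X\to Z$ with $j[X]\in\mathbf{\Sigma}^1_1(Z)$. *)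

theory Defs
  imports "HOL-Analysis.Analysis"
begin

definition Polish_space :: "'a topology \<Rightarrow> bool" where
  "Polish_space Z \<longleftrightarrow> separable_space Z \<and> completely_metrizable_space Z"

definition zero_dimensional_space :: "'a topology \<Rightarrow> bool" where
  "zero_dimensional_space X \<longleftrightarrow>
     (\<exists>\<B>. (\<forall>V \<in> \<B>. openin X V \<and> closedin X V) \<and>
          (\<forall>U x. openin X U \<and> x \<in> U \<longrightarrow> (\<exists>V \<in> \<B>. x \<in> V \<and> V \<subseteq> U)))"

definition homogeneous_space :: "'a topology \<Rightarrow> bool" where
  "homogeneous_space X \<longleftrightarrow>
     (\<forall>x \<in> topspace X. \<forall>y \<in> topspace X. \<exists>h. homeomorphic_map X X h \<and> h x = y)"

text \<open>
  The existentially quantified Polish spaces below cannot range over all types, so they range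
  over all topologies on arbitrary carrier subsets of the type \<open>nat \<Rightarrow> nat\<close> (not just over the
  Baire space). This is no restriction: every Polish space, over whatever type, has at most
  continuum many points and hence is homeomorphic to such a topology
  (\<open>Polish_space_homeomorphic_copy\<close>). The introduction rules \<open>analytic_inI\<close>, \<open>Sigma11I\<close> and
  \<open>analytic_spaceI\<close> at the end accept Polish spaces over arbitrary types.
\<close>

text \<open>Analytic subsets of a Polish space: continuous images of Polish spaces. The empty set is
  included, because the empty space is Polish.\<close>

definition analytic_in :: "'a topology \<Rightarrow> 'a set \<Rightarrow> bool" where
  "analytic_in Z A \<longleftrightarrow>
     (\<exists>(Y :: (nat \<Rightarrow> nat) topology) f.
        Polish_space Y \<and> continuous_map Y Z f \<and> f ` topspace Y = A)"

text \<open>The class \<open>\<Sigma>\<^sup>1\<^sub>1(X)\<close> for an arbitrary space \<open>X\<close>.\<close>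

definition Sigma11 :: "'a topology \<Rightarrow> 'a set set" where
  "Sigma11 X = {A. A \<subseteq> topspace X \<and>
     (\<exists>(Z :: (nat \<Rightarrow> nat) topology) j A'.
        Polish_space Z \<and> embedding_map X Z j \<and> analytic_in Z A' \<and>
        j ` A = A' \<inter> j ` topspace X)}"

definition analytic_space :: "'a topology \<Rightarrow> bool" where
  "analytic_space X \<longleftrightarrow>
     (\<exists>(Z :: (nat \<Rightarrow> nat) topology) j.
        Polish_space Z \<and> embedding_map X Z j \<and> analytic_in Z (j ` topspace X))"

lemma separable_metrizable_inj:
  fixes Z :: "'a topology"
  assumes "separable_space Z" "metrizable_space Z"
  shows "\<exists>g :: 'a \<Rightarrow> nat \<Rightarrow> nat. inj_on g (topspace Z)"
proof -
  obtain M d where M: "Metric_space M d" and Z: "Z = Metric_space.mtopology M d"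
    using assms(2) by (auto simp: metrizable_space_def)
  interpret Metric_space M d by fact
  obtain C where C: "countable C" "C \<subseteq> M" "Z closure_of C = M"
    using assms(1) by (auto simp: separable_space_def Z)
  define g :: "'a \<Rightarrow> nat \<Rightarrow> nat" where
    "g = (\<lambda>x k. if d x (from_nat_into C (fst (prod_decode k))) < inverse (Suc (snd (prod_decode k)))
                then 1 else 0)"
  have "inj_on g M"
  proof (rule inj_onI, rule ccontr)
    fix x y assume xy: "x \<in> M" "y \<in> M" "g x = g y" "x \<noteq> y"
    then have "d x y / 2 > 0" by simp
    then obtain n where n: "inverse (real (Suc n)) < d x y / 2"
      using reals_Archimedean by blast
    have "x \<in> mtopology closure_of C" using C(3) Z xy(1) by simp
    then obtain c where c: "c \<in> C" "d x c < inverse (real (Suc n))"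
      using xy(1)
      by (smt (verit, best) in_mball inverse_positive_iff_positive metric_closure_of
          mem_Collect_eq of_nat_0_less_iff zero_less_Suc)
    define k where "k = prod_encode (to_nat_on C c, n)"
    have k: "from_nat_into C (fst (prod_decode k)) = c" "snd (prod_decode k) = n"
      using C(1) c(1) by (auto simp: k_def)
    have "g x k = 1" using c(2) k by (simp add: g_def)
    then have "g y k = 1" using xy(3) by simp
    then have "d y c < inverse (real (Suc n))" using k by (auto simp: g_def split: if_splits)
    moreover have "d x y \<le> d x c + d y c"
      using triangle'' C(2) c(1) xy commute triangle by (metis subsetD)
    ultimately show False using c(2) n by linarith
  qed
  then show ?thesis using Z by auto
qed

lemma Polish_space_homeomorphic_copy:
  fixes Z :: "'a topology"
  assumes "Polish_space Z"
  shows "\<exists>Z' :: (nat \<Rightarrow> nat) topology. Polish_space Z' \<and> Z homeomorphic_space Z'"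
proof -
  have "metrizable_space Z"
    using assms by (simp add: Polish_space_def completely_metrizable_imp_metrizable_space)
  then obtain g :: "'a \<Rightarrow> nat \<Rightarrow> nat" where g: "inj_on g (topspace Z)"
    using assms separable_metrizable_inj unfolding Polish_space_def by blast
  define h where "h = inv_into (topspace Z) g"
  define Z' where "Z' = pullback_topology (g ` topspace Z) h Z"
  have hg: "h (g x) = x" if "x \<in> topspace Z" for x
    using that g by (simp add: h_def)
  have top: "topspace Z' = g ` topspace Z"
    using hg by (auto simp: Z'_def topspace_pullback_topology)
  have "homeomorphic_maps Z Z' g h"
    unfolding homeomorphic_maps_def
  proof (intro conjI ballI)
    have "continuous_map Z Z (h \<circ> g)"
      by (rule continuous_map_eq[of Z Z id]) (auto simp: hg)
    then show "continuous_map Z Z' g"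
      unfolding Z'_def by (intro continuous_map_pullback') auto
    show "continuous_map Z' Z h"
      unfolding Z'_def using continuous_map_pullback[OF continuous_map_id]
      by (metis id_comp)
  qed (auto simp: hg top)
  then have Z: "Z homeomorphic_space Z'"
    by (rule homeomorphic_maps_imp_homeomorphic_space)
  then have "Polish_space Z'"
    using assms homeomorphic_separable_space homeomorphic_completely_metrizable_space
    unfolding Polish_space_def by blast
  with Z show ?thesis by blast
qed

lemma analytic_inI:
  assumes "Polish_space Y" "continuous_map Y Z f" "f ` topspace Y = A"
  shows "analytic_in Z A"
proof -
  obtain Y' :: "(nat \<Rightarrow> nat) topology" and h k where Y': "Polish_space Y'" "homeomorphic_maps Y Y' h k"
    using Polish_space_homeomorphic_copy[OF assms(1)] unfolding homeomorphic_space_def by blast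
  then have k: "continuous_map Y' Y k" "k ` topspace Y' = topspace Y"
    by (auto simp: homeomorphic_maps_map homeomorphic_imp_continuous_map
        dest: homeomorphic_imp_surjective_map)
  then have "continuous_map Y' Z (f \<circ> k)" "(f \<circ> k) ` topspace Y' = A"
    using assms by (blast intro: continuous_map_compose, metis image_comp)
  with Y'(1) show ?thesis unfolding analytic_in_def by blast
qed

lemma Polish_embedding_copy:
  assumes "Polish_space (Z :: 'b topology)" "embedding_map X Z j" "analytic_in Z A"
  shows "\<exists>(Z' :: (nat \<Rightarrow> nat) topology) h. Polish_space Z' \<and> embedding_map X Z' (h \<circ> j) \<and>
           analytic_in Z' (h ` A) \<and> inj_on h (topspace Z) \<and> A \<subseteq> topspace Z"
proof -
  obtain Z' :: "(nat \<Rightarrow> nat) topology" and h where Z': "Polish_space Z'" "homeomorphic_map Z Z' h"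
    using Polish_space_homeomorphic_copy[OF assms(1)] unfolding homeomorphic_space by blast
  have "embedding_map Z Z' h"
    using Z'(2) by (auto simp: embedding_map_def homeomorphic_imp_surjective_map)
  then have e: "embedding_map X Z' (h \<circ> j)"
    using assms(2) embedding_map_compose by blast
  obtain Y :: "(nat \<Rightarrow> nat) topology" and f where
    Y: "Polish_space Y" "continuous_map Y Z f" "f ` topspace Y = A"
    using assms(3) unfolding analytic_in_def by blast
  have "continuous_map Y Z' (h \<circ> f)" "(h \<circ> f) ` topspace Y = h ` A"
    using Y Z'(2) homeomorphic_imp_continuous_map continuous_map_compose by (blast, force)
  with Y(1) have "analytic_in Z' (h ` A)" by (rule analytic_inI)
  moreover have "A \<subseteq> topspace Z" using Y continuous_map_image_subset_topspace by blast
  ultimately show ?thesis using Z' e homeomorphic_imp_injective_map by blast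
qed

lemma Sigma11I:
  assumes Z: "Polish_space Z" "embedding_map X Z j" "analytic_in Z A'"
    and A: "A \<subseteq> topspace X" "j ` A = A' \<inter> j ` topspace X"
  shows "A \<in> Sigma11 X"
proof -
  obtain Z' :: "(nat \<Rightarrow> nat) topology" and h where
    Z': "Polish_space Z'" "embedding_map X Z' (h \<circ> j)" "analytic_in Z' (h ` A')"
        "inj_on h (topspace Z)" "A' \<subseteq> topspace Z"
    using Polish_embedding_copy[OF Z] by blast
  have "j ` topspace X \<subseteq> topspace Z"
    using Z(2) embedding_map_def homeomorphic_imp_surjective_map
    by (metis inf_le1 topspace_subtopology)
  then have "h ` (A' \<inter> j ` topspace X) = h ` A' \<inter> h ` (j ` topspace X)"
    using Z'(4,5) inj_on_image_Int by metis
  then have "(h \<circ> j) ` A = h ` A' \<inter> (h \<circ> j) ` topspace X"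
    using A(2) by (metis image_comp)
  with Z' A(1) show ?thesis unfolding Sigma11_def by blast
qed

lemma analytic_spaceI:
  assumes "Polish_space Z" "embedding_map X Z j" "analytic_in Z (j ` topspace X)"
  shows "analytic_space X"
  using Polish_embedding_copy[OF assms] unfolding analytic_space_def
  by (metis image_comp)

end

theory Submission
  imports Defs "HOL-Library.Sublist"
begin

text \<open>
  The pieces of the required covering may overlap, and this is what the proof exploits: instead of
  cutting \<open>X\<close> into homogeneous parts, a given part of \<open>X\<close> is enlarged, inside \<open>X\<close>, until it is
  homogeneous.
  
  A zero-dimensional separable metrizable space embeds in the Cantor space
  (\<open>zero_dimensional_embeds_in_Cantor\<close>), so let \<open>X\<close> be an analytic set of binary sequences. The sets
  that are covered by countably many homogeneous analytic subsets of \<open>X\<close> form a sigma-ideal that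
  contains the countable subsets of \<open>X\<close>. Removing from \<open>X\<close> all relatively open covered sets removes
  only a covered set and leaves an analytic set \<open>A\<close> in which no nonempty relatively open set is
  covered; in particular all of these are uncountable, and therefore contain copies of the Cantor
  space (\<open>perfect_set\<close>).
  
  Relatively closed nowhere dense sets \<open>N\<close> of \<open>A\<close> are covered
  (\<open>nowhere_dense_subset_of_homogeneous\<close>). Send a point of \<open>N\<close> to the point evaluation at it, which is a
  function from the cylinders to the field with two elements. The evaluations span a Boolean group
  \<open>H\<close>, homogeneous by translations, analytic because \<open>N\<close> is, and containing a closed copy of \<open>N\<close>.
  Identify the copy with \<open>N\<close>.
  The complement of \<open>N\<close> in \<open>H\<close> splits into clopen pieces that shrink towards \<open>N\<close>. As \<open>N\<close> is nowhere dense
  in \<open>A\<close>, every piece can be embedded in a small Cantor set inside \<open>A\<close>, off \<open>N\<close>, but close to the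
  same point of \<open>N\<close> as the piece itself. These embeddings and the identity of \<open>N\<close> combine to an
  embedding of \<open>H\<close> in \<open>A\<close> (\<open>extend_embedding\<close>), whose image is a homogeneous analytic set between
  \<open>N\<close> and \<open>A\<close>.
  
  It remains to treat the part of \<open>A\<close> of second category (\<open>conull_copy_of_Baire_space\<close>). Follow a
  parametrization of \<open>A\<close> by the Baire space along a tree of disjoint cylinders, choosing at each
  node an infinite family of smaller cylinders whose union is dense and in which one of the next
  parts of the parametrization is nowhere negligible. The branches of the tree form a copy of the
  Baire space inside \<open>A\<close>, and what they miss lies in countably many nowhere dense sets. So \<open>A\<close>, and
  with it \<open>X\<close>, is covered.
\<close>

section \<open>Sequences and cylinders\<close>

definition pre :: "(nat \<Rightarrow> 'a) \<Rightarrow> nat \<Rightarrow> 'a list" where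
  "pre x n = map x [0..<n]"

definition cyl :: "'a list \<Rightarrow> (nat \<Rightarrow> 'a) set" where
  "cyl u = {x. pre x (length u) = u}"

lemma length_pre [simp]: "length (pre x n) = n"
  by (simp add: pre_def)

lemma pre_0 [simp]: "pre x 0 = []"
  by (simp add: pre_def)

lemma pre_Suc: "pre x (Suc n) = pre x n @ [x n]"
  by (simp add: pre_def)

lemma pre_eq_iff: "pre x n = pre y n \<longleftrightarrow> (\<forall>i<n. x i = y i)"
  by (auto simp: pre_def)

lemma pre_eq_mono: "pre x n = pre y n \<Longrightarrow> m \<le> n \<Longrightarrow> pre x m = pre y m"
  by (auto simp: pre_eq_iff)

lemma take_pre: "m \<le> n \<Longrightarrow> take m (pre x n) = pre x m"
  by (simp add: pre_def take_map)

lemma in_cyl_pre [simp]: "y \<in> cyl (pre x n) \<longleftrightarrow> pre y n = pre x n"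
  by (simp add: cyl_def)

lemma cyl_Nil [simp]: "cyl [] = UNIV"
  by (simp add: cyl_def)

lemma in_cylD: "x \<in> cyl u \<Longrightarrow> pre x (length u) = u"
  by (simp add: cyl_def)

lemma prefix_pre: "m \<le> n \<Longrightarrow> prefix (pre x m) (pre x n)"
  by (metis take_is_prefix take_pre)

lemma prefix_pre_iff: "prefix u (pre x n) \<longleftrightarrow> x \<in> cyl u \<and> length u \<le> n"
proof
  assume u: "prefix u (pre x n)"
  then have le: "length u \<le> n" using prefix_length_le by fastforce
  have "u = take (length u) (pre x n)" using u by (auto simp: prefix_def)
  then show "x \<in> cyl u \<and> length u \<le> n" using le by (simp add: cyl_def take_pre)
next
  assume "x \<in> cyl u \<and> length u \<le> n"
  then show "prefix u (pre x n)" using prefix_pre[of "length u" n x] by (simp add: cyl_def)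
qed

lemma cyl_mono: "prefix u v \<Longrightarrow> cyl v \<subseteq> cyl u"
proof
  fix x assume "prefix u v" "x \<in> cyl v"
  then show "x \<in> cyl u" using prefix_pre_iff[of u x "length v"] by (simp add: cyl_def)
qed

lemma in_two_cyls:
  assumes "x \<in> cyl u" "x \<in> cyl v" "length u \<le> length v"
  shows "prefix u v"
  using assms prefix_pre_iff[of u x "length v"] by (simp add: cyl_def)

lemma in_cyl_iff: "x \<in> cyl u \<longleftrightarrow> (\<forall>i<length u. x i = u ! i)"
  using list_eq_iff_nth_eq[of "pre x (length u)" u] by (simp add: cyl_def pre_def)

lemma eq_if_pre_eq:
  assumes "\<And>n. pre x n = pre y n"
  shows "x = y"
proof
  fix i
  have "pre x (Suc i) = pre y (Suc i)" by (rule assms)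
  then show "x i = y i" unfolding pre_Suc by blast
qed

lemma open_cyl:
  fixes u :: "'a :: discrete_topology list"
  shows "open (cyl u)"
proof -
  have eq: "cyl u = (\<Inter>i\<in>{..<length u}. (\<lambda>x. x i) -` {u ! i})"
    by (auto simp: in_cyl_iff)
  have "open ((\<lambda>x::nat \<Rightarrow> 'a. x i) -` {u ! i})" for i
    by (rule open_vimage[OF open_discrete]) simp
  then show ?thesis unfolding eq by (intro open_INT) auto
qed

lemma closed_cyl:
  fixes u :: "'a :: discrete_topology list"
  shows "closed (cyl u)"
proof -
  have eq: "cyl u = (\<Inter>i\<in>{..<length u}. (\<lambda>x. x i) -` {u ! i})"
    by (auto simp: in_cyl_iff)
  have "closed ((\<lambda>x::nat \<Rightarrow> 'a. x i) -` {u ! i})" for i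
    by (rule closed_vimage) (simp_all add: closed_def open_discrete)
  then show ?thesis unfolding eq by (intro closed_INT) auto
qed

lemma open_contains_cyl:
  fixes U :: "(nat \<Rightarrow> 'a :: discrete_topology) set"
  assumes "open U" "x \<in> U"
  shows "\<exists>n. cyl (pre x n) \<subseteq> U"
proof -
  have "openin (product_topology (\<lambda>i. euclidean) UNIV) U"
    using assms(1) by (simp add: euclidean_product_topology)
  from product_topology_open_contains_basis[OF this assms(2)]
  obtain V where V: "x \<in> (\<Pi>\<^sub>E i\<in>UNIV. V i)" "finite {i. V i \<noteq> UNIV}" "(\<Pi>\<^sub>E i\<in>UNIV. V i) \<subseteq> U"
    unfolding topspace_euclidean by (elim exE conjE) (rule that, assumption+)
  obtain n where n: "\<forall>i\<in>{i. V i \<noteq> UNIV}. i < n"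
    using V(2) finite_nat_set_iff_bounded[THEN iffD1] by blast
  have "y \<in> (\<Pi>\<^sub>E i\<in>UNIV. V i)" if y: "pre y n = pre x n" for y
    unfolding PiE_UNIV_domain Pi_iff
  proof
    fix i
    show "y i \<in> V i"
    proof (cases "V i = UNIV")
      case False
      then have "y i = x i" using n y by (simp add: pre_eq_iff)
      then show ?thesis using V(1) by (simp add: PiE_UNIV_domain Pi_iff)
    qed simp
  qed
  then have "cyl (pre x n) \<subseteq> (\<Pi>\<^sub>E i\<in>UNIV. V i)" by (intro subsetI) (simp only: in_cyl_pre)
  then show ?thesis using V(3) by blast
qed

lemma continuous_on_pre_iff:
  fixes f :: "(nat \<Rightarrow> 'a :: discrete_topology) \<Rightarrow> (nat \<Rightarrow> 'b :: discrete_topology)"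
  shows "continuous_on S f \<longleftrightarrow>
    (\<forall>x\<in>S. \<forall>n. \<exists>m. \<forall>y\<in>S. pre y m = pre x m \<longrightarrow> pre (f y) n = pre (f x) n)"
proof
  assume f: "continuous_on S f"
  show "\<forall>x\<in>S. \<forall>n. \<exists>m. \<forall>y\<in>S. pre y m = pre x m \<longrightarrow> pre (f y) n = pre (f x) n"
  proof (intro ballI allI)
    fix x n assume x: "x \<in> S"
    obtain A where A: "open A" "A \<inter> S = f -` cyl (pre (f x) n) \<inter> S"
      using f open_cyl unfolding continuous_on_open_invariant by blast
    then have "x \<in> A" using x by auto
    then obtain m where "cyl (pre x m) \<subseteq> A" using open_contains_cyl A(1) by blast
    then have "pre (f y) n = pre (f x) n" if "y \<in> S" "pre y m = pre x m" for y
    proof -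
      have "y \<in> A \<inter> S" using that \<open>cyl (pre x m) \<subseteq> A\<close> by auto
      then show ?thesis using A(2) by simp
    qed
    then show "\<exists>m. \<forall>y\<in>S. pre y m = pre x m \<longrightarrow> pre (f y) n = pre (f x) n" by blast
  qed
next
  assume f: "\<forall>x\<in>S. \<forall>n. \<exists>m. \<forall>y\<in>S. pre y m = pre x m \<longrightarrow> pre (f y) n = pre (f x) n"
  show "continuous_on S f"
    unfolding continuous_on_topological
  proof (intro ballI allI impI)
    fix x B assume x: "x \<in> S" "open B" "f x \<in> B"
    then obtain n where n: "cyl (pre (f x) n) \<subseteq> B" using open_contains_cyl by blast
    obtain m where m: "\<forall>y\<in>S. pre y m = pre x m \<longrightarrow> pre (f y) n = pre (f x) n"
      using f x(1) by blast
    show "\<exists>A. open A \<and> x \<in> A \<and> (\<forall>y\<in>S. y \<in> A \<longrightarrow> f y \<in> B)"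
      using n m by (intro exI[of _ "cyl (pre x m)"]) (auto simp: open_cyl)
  qed
qed

text \<open>
  Embeddings of sets of sequences in terms of initial segments: continuity of \<open>f\<close> on \<open>S\<close> and of its
  inverse on the image. The second clause includes injectivity.
\<close>

definition emb :: "(nat \<Rightarrow> 'a) set \<Rightarrow> ((nat \<Rightarrow> 'a) \<Rightarrow> (nat \<Rightarrow> 'b)) \<Rightarrow> bool" where
  "emb S f \<longleftrightarrow> (\<forall>x\<in>S. \<forall>n.
     (\<exists>m. \<forall>y\<in>S. pre y m = pre x m \<longrightarrow> pre (f y) n = pre (f x) n) \<and>
     (\<exists>m. \<forall>y\<in>S. pre (f y) m = pre (f x) m \<longrightarrow> pre y n = pre x n))"

lemma emb_imp_continuous_on:
  fixes f :: "(nat \<Rightarrow> 'a :: discrete_topology) \<Rightarrow> (nat \<Rightarrow> 'b :: discrete_topology)"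
  shows "emb S f \<Longrightarrow> continuous_on S f"
  unfolding emb_def continuous_on_pre_iff by blast

lemma emb_imp_inj_on: "emb S f \<Longrightarrow> inj_on f S"
  unfolding emb_def inj_on_def by (metis eq_if_pre_eq)

lemma emb_compose:
  assumes "emb S f" "emb T g" "f ` S \<subseteq> T"
  shows "emb S (g \<circ> f)"
  unfolding emb_def
proof (intro ballI allI conjI)
  fix x n assume x: "x \<in> S"
  obtain k where k: "\<forall>y\<in>T. pre y k = pre (f x) k \<longrightarrow> pre (g y) n = pre (g (f x)) n"
    using assms x unfolding emb_def by blast
  obtain m where "\<forall>y\<in>S. pre y m = pre x m \<longrightarrow> pre (f y) k = pre (f x) k"
    using assms x unfolding emb_def by blast
  then show "\<exists>m. \<forall>y\<in>S. pre y m = pre x m \<longrightarrow> pre ((g \<circ> f) y) n = pre ((g \<circ> f) x) n"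
    using k assms(3) by (metis comp_apply image_subset_iff)
  obtain k where k: "\<forall>y\<in>S. pre (f y) k = pre (f x) k \<longrightarrow> pre y n = pre x n"
    using assms x unfolding emb_def by blast
  obtain m where "\<forall>y\<in>T. pre (g y) m = pre (g (f x)) m \<longrightarrow> pre y k = pre (f x) k"
    using assms x unfolding emb_def by blast
  then show "\<exists>m. \<forall>y\<in>S. pre ((g \<circ> f) y) m = pre ((g \<circ> f) x) m \<longrightarrow> pre y n = pre x n"
    using k assms(3) by (metis comp_apply image_subset_iff)
qed

lemma emb_homeomorphic_space:
  fixes f :: "(nat \<Rightarrow> 'a :: discrete_topology) \<Rightarrow> (nat \<Rightarrow> 'b :: discrete_topology)"
  assumes "emb S f"
  shows "top_of_set S homeomorphic_space top_of_set (f ` S)"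
proof -
  have inj: "inj_on f S" using assms by (rule emb_imp_inj_on)
  have "continuous_on (f ` S) (inv_into S f)"
    unfolding continuous_on_pre_iff
  proof (intro ballI allI)
    fix z n assume "z \<in> f ` S"
    then obtain x where x: "x \<in> S" "z = f x" by blast
    obtain m where m: "\<forall>y\<in>S. pre (f y) m = pre (f x) m \<longrightarrow> pre y n = pre x n"
      using assms x(1) unfolding emb_def by blast
    have "pre (inv_into S f (f y)) n = pre (inv_into S f z) n"
      if "y \<in> S" "pre (f y) m = pre z m" for y
      unfolding x(2) inv_into_f_f[OF inj x(1)] inv_into_f_f[OF inj that(1)]
      using m that x(2) by blast
    then show "\<exists>m. \<forall>y\<in>f ` S. pre y m = pre z m \<longrightarrow>
        pre (inv_into S f y) n = pre (inv_into S f z) n"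
      by blast
  qed
  then have "homeomorphic_maps (top_of_set S) (top_of_set (f ` S)) f (inv_into S f)"
    using emb_imp_continuous_on[OF assms] inj
    by (auto simp: homeomorphic_maps_def continuous_map_in_subtopology inv_into_f_f inv_into_into)
  then show ?thesis by (rule homeomorphic_maps_imp_homeomorphic_space)
qed

section \<open>Homogeneous spaces\<close>

lemma homogeneous_space_homeomorphic:
  assumes "homogeneous_space X" "X homeomorphic_space Y"
  shows "homogeneous_space Y"
proof -
  obtain f g where fg: "homeomorphic_maps X Y f g"
    using assms(2) unfolding homeomorphic_space_def by blast
  have f: "homeomorphic_map X Y f" and g: "homeomorphic_map Y X g"
    using fg homeomorphic_maps_map by auto
  show ?thesis unfolding homogeneous_space_def
  proof (intro ballI)
    fix x y assume xy: "x \<in> topspace Y" "y \<in> topspace Y"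
    then have "g x \<in> topspace X" "g y \<in> topspace X"
      using g homeomorphic_imp_surjective_map by blast+
    then obtain h where h: "homeomorphic_map X X h" "h (g x) = g y"
      using assms(1) unfolding homogeneous_space_def by blast
    have "homeomorphic_map Y Y (f \<circ> (h \<circ> g))"
      by (intro homeomorphic_map_compose[OF homeomorphic_map_compose[OF g h(1)] f])
    moreover have "(f \<circ> (h \<circ> g)) x = y"
      using h(2) xy(2) fg by (simp add: homeomorphic_maps_def)
    ultimately show "\<exists>h. homeomorphic_map Y Y h \<and> h x = y" by blast
  qed
qed

lemma homogeneous_singleton: "homogeneous_space (top_of_set {x})"
  unfolding homogeneous_space_def by (auto intro: exI[of _ id])

lemma homogeneous_space_empty: "homogeneous_space (top_of_set {})"
  by (simp add: homogeneous_space_def)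

text \<open>
  Exchanging the values \<open>x i\<close> and \<open>y i\<close> in the \<open>i\<close>-th coordinate, for all \<open>i\<close>, is an involution that
  moves \<open>x\<close> to \<open>y\<close>.
\<close>

lemma homogeneous_Baire: "homogeneous_space (euclidean :: (nat \<Rightarrow> nat) topology)"
  unfolding homogeneous_space_def
proof (intro ballI)
  fix x y :: "nat \<Rightarrow> nat"
  define h where "h z i = (if z i = x i then y i else if z i = y i then x i else z i)"
    for z :: "nat \<Rightarrow> nat" and i
  have hh: "h (h z) = z" for z by (auto simp: h_def fun_eq_iff)
  have "continuous_on UNIV h"
    unfolding continuous_on_pre_iff
  proof (intro ballI allI)
    fix z n
    have "pre (h w) n = pre (h z) n" if "pre w n = pre z n" for w
      using that by (simp add: pre_eq_iff h_def)
    then show "\<exists>m. \<forall>w\<in>UNIV. pre w m = pre z m \<longrightarrow> pre (h w) n = pre (h z) n" by blast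
  qed
  then have "homeomorphic_maps euclidean euclidean h h"
    using hh by (simp add: homeomorphic_maps_def)
  then have "homeomorphic_map euclidean euclidean h" using homeomorphic_maps_map by blast
  moreover have "h x = y" by (simp add: h_def fun_eq_iff)
  ultimately show "\<exists>h. homeomorphic_map euclidean euclidean h \<and> h x = y" by blast
qed

section \<open>Analytic sets as images of the Baire space\<close>

lemma second_countable_sequences:
  fixes S :: "(nat \<Rightarrow> 'a :: {countable, discrete_topology}) set"
  shows "second_countable (top_of_set S)"
proof (rule second_countable_subtopology)
  show "second_countable (euclidean :: (nat \<Rightarrow> 'a) topology)"
    unfolding second_countable_def
  proof (intro exI conjI ballI allI impI)
    show "countable (range (cyl :: 'a list \<Rightarrow> (nat \<Rightarrow> 'a) set))" by simp
    show "openin euclidean V" if "V \<in> range cyl" for V :: "(nat \<Rightarrow> 'a) set"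
      using that open_cyl by auto
    show "\<exists>V\<in>range cyl. x \<in> V \<and> V \<subseteq> U" if U: "openin euclidean U \<and> x \<in> U"
      for U and x :: "nat \<Rightarrow> 'a"
    proof -
      obtain n where "cyl (pre x n) \<subseteq> U" using open_contains_cyl[of U x] U unfolding open_openin[symmetric] by blast
      then show ?thesis by (intro bexI[of _ "cyl (pre x n)"]) auto
    qed
  qed
qed

lemma Polish_space_closed_Baire:
  fixes C :: "(nat \<Rightarrow> nat) set"
  assumes "closed C"
  shows "Polish_space (top_of_set C)"
proof -
  have nat: "(euclidean :: nat topology) = discrete_topology UNIV"
    by (rule topology_eq[THEN iffD2]) (simp add: open_discrete)
  have "completely_metrizable_space (euclidean :: nat topology)"
    unfolding nat by (rule completely_metrizable_space_discrete_topology)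
  then have "completely_metrizable_space (product_topology (\<lambda>i::nat. euclidean :: nat topology) UNIV)"
    unfolding completely_metrizable_space_product_topology by simp
  then have "completely_metrizable_space (top_of_set C)"
    unfolding euclidean_product_topology
    using assms completely_metrizable_space_closedin by (metis closed_closedin)
  then show ?thesis
    unfolding Polish_space_def
    using second_countable_imp_separable_space[OF second_countable_sequences] by blast
qed

lemma Polish_space_Baire: "Polish_space (euclidean :: (nat \<Rightarrow> nat) topology)"
  using Polish_space_closed_Baire[of UNIV] by simp

text \<open>
  A sequence of indices \<open>\<alpha>\<close> is read as instructions to move through a countable dense set, where
  a move that is too long for its turn is ignored. The resulting sequence of points is Cauchy
  for every \<open>\<alpha>\<close>, its limit depends continuously on \<open>\<alpha>\<close>, and every point is such a limit.
\<close>

lemma (in Metric_space) Baire_space_onto_complete: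
  assumes C: "countable C" "C \<subseteq> M" "mtopology closure_of C = M" and complete: mcomplete
    and ne: "M \<noteq> {}"
  shows "\<exists>L. continuous_map (euclidean :: (nat \<Rightarrow> nat) topology) mtopology L \<and> range L = M"
proof -
  have near: "\<exists>y\<in>C. d x y < r" if "x \<in> M" "r > 0" for x r
    using C(3) that unfolding metric_closure_of by (auto simp: in_mball)
  then have "C \<noteq> {}" using ne by (metis ex_in_conv zero_less_one)
  define c where "c = from_nat_into C"
  have c: "c n \<in> M" for n
    using from_nat_into[OF \<open>C \<noteq> {}\<close>] C(2) by (auto simp: c_def)
  have near: "\<exists>n. d (c n) x < r" if x: "x \<in> M" and r: "r > 0" for x r
  proof -
    obtain y where "y \<in> C" "d x y < r" using near x r by blast
    moreover then obtain n where "c n = y"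
      using from_nat_into_surj[OF C(1)] by (auto simp: c_def)
    ultimately show ?thesis by (metis commute)
  qed
  define s :: "(nat \<Rightarrow> nat) \<Rightarrow> nat \<Rightarrow> 'a" where
    "s = (\<lambda>\<alpha>. rec_nat (c (\<alpha> 0))
            (\<lambda>n y. if d y (c (\<alpha> (Suc n))) < (1/2) ^ n then c (\<alpha> (Suc n)) else y))"
  have s0: "s \<alpha> 0 = c (\<alpha> 0)"
    and sS: "s \<alpha> (Suc n) = (if d (s \<alpha> n) (c (\<alpha> (Suc n))) < (1/2) ^ n then c (\<alpha> (Suc n)) else s \<alpha> n)"
    for \<alpha> n by (simp_all add: s_def)
  have sM: "s \<alpha> n \<in> M" for \<alpha> n
    by (induction n) (auto simp: s0 sS c)
  have step: "d (s \<alpha> n) (s \<alpha> (Suc n)) \<le> (1/2) ^ n" for \<alpha> n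
    using sM by (auto simp: sS)
  have dist: "d (s \<alpha> n) (s \<alpha> (n + k)) \<le> 2 * (1/2) ^ n - 2 * (1/2) ^ (n + k)" for \<alpha> n k
  proof (induction k)
    case 0
    show ?case using sM by simp
  next
    case (Suc k)
    have "d (s \<alpha> n) (s \<alpha> (n + Suc k)) \<le> d (s \<alpha> n) (s \<alpha> (n + k)) + d (s \<alpha> (n + k)) (s \<alpha> (n + Suc k))"
      using triangle sM by blast
    then show ?case using Suc step[of \<alpha> "n + k"] by simp
  qed
  have dist': "d (s \<alpha> n) (s \<alpha> m) \<le> 2 * (1/2) ^ n" if nm: "n \<le> m" for \<alpha> n m
  proof -
    obtain k where k: "m = n + k" using le_Suc_ex[OF nm] by blast
    have "0 < (1/2::real) ^ (n + k)" by simp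
    then show ?thesis using dist[of \<alpha> n k] unfolding k by linarith
  qed
  have small: "\<exists>n. 4 * (1/2) ^ n < r" if r: "r > 0" for r :: real
  proof -
    obtain n where "(1/2) ^ n < r / 4" using real_arch_pow_inv[of "r / 4" "1/2"] r by auto
    then have "4 * (1/2) ^ n < r" by linarith
    then show ?thesis by blast
  qed
  have "MCauchy (s \<alpha>)" for \<alpha>
    unfolding MCauchy_def
  proof (intro conjI allI impI)
    fix \<epsilon> :: real assume "\<epsilon> > 0"
    then obtain N where N: "4 * (1/2) ^ N < \<epsilon>" using small by blast
    show "\<exists>N. \<forall>n n'. N \<le> n \<longrightarrow> N \<le> n' \<longrightarrow> d (s \<alpha> n) (s \<alpha> n') < \<epsilon>"
    proof (intro exI allI impI)
      fix n n' assume "N \<le> n" "N \<le> n'"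
      then have "d (s \<alpha> N) (s \<alpha> n) \<le> 2 * (1/2) ^ N" "d (s \<alpha> N) (s \<alpha> n') \<le> 2 * (1/2) ^ N"
        using dist' by auto
      moreover have "d (s \<alpha> n) (s \<alpha> n') \<le> d (s \<alpha> N) (s \<alpha> n) + d (s \<alpha> N) (s \<alpha> n')"
        by (rule triangle''[OF sM sM sM])
      ultimately show "d (s \<alpha> n) (s \<alpha> n') < \<epsilon>" using N by linarith
    qed
  qed (use sM in auto)
  then have "\<exists>x. limitin mtopology (s \<alpha>) x sequentially" for \<alpha>
    using complete by (simp add: mcomplete_def)
  then obtain L where L: "\<And>\<alpha>. limitin mtopology (s \<alpha>) (L \<alpha>) sequentially" by metis
  have LM: "L \<alpha> \<in> M" for \<alpha> using L limit_metric_sequentially by blast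
  have dL: "d (s \<alpha> n) (L \<alpha>) \<le> 2 * (1/2) ^ n" for \<alpha> n
  proof (rule field_le_epsilon)
    fix e :: real assume "e > 0"
    then obtain N where N: "\<forall>k\<ge>N. d (s \<alpha> k) (L \<alpha>) < e"
      using L limit_metric_sequentially by blast
    have "d (s \<alpha> n) (L \<alpha>) \<le> d (s \<alpha> n) (s \<alpha> (max N n)) + d (s \<alpha> (max N n)) (L \<alpha>)"
      using triangle sM LM by blast
    moreover have "d (s \<alpha> (max N n)) (L \<alpha>) < e" using N by simp
    moreover have "d (s \<alpha> n) (s \<alpha> (max N n)) \<le> 2 * (1/2) ^ n" using dist' by simp
    ultimately show "d (s \<alpha> n) (L \<alpha>) \<le> 2 * (1/2) ^ n + e" by linarith
  qed
  have "continuous_map euclidean mtopology L"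
    unfolding continuous_map_to_metric
  proof (intro ballI allI impI)
    fix \<alpha> and \<epsilon> :: real assume "\<epsilon> > 0"
    then obtain n where n: "4 * (1/2) ^ n < \<epsilon>" using small by blast
    have "L \<beta> \<in> mball (L \<alpha>) \<epsilon>" if \<beta>: "\<beta> \<in> cyl (pre \<alpha> (Suc n))" for \<beta>
    proof -
      have eq: "\<beta> i = \<alpha> i" if "i \<le> n" for i
        using \<beta> that by (simp add: pre_eq_iff)
      have "s \<beta> k = s \<alpha> k" if "k \<le> n" for k
        using that by (induction k) (auto simp: s0 sS eq)
      then have "d (s \<alpha> n) (L \<beta>) \<le> 2 * (1/2) ^ n" using dL[of \<beta> n] by simp
      moreover have "d (L \<alpha>) (L \<beta>) \<le> d (s \<alpha> n) (L \<alpha>) + d (s \<alpha> n) (L \<beta>)"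
        by (rule triangle''[OF LM sM LM])
      ultimately have "d (L \<alpha>) (L \<beta>) < \<epsilon>" using dL[of \<alpha> n] n by linarith
      then show ?thesis using LM by (simp add: in_mball)
    qed
    then show "\<exists>U. openin euclidean U \<and> \<alpha> \<in> U \<and> (\<forall>\<beta>\<in>U. L \<beta> \<in> mball (L \<alpha>) \<epsilon>)"
      by (intro exI[of _ "cyl (pre \<alpha> (Suc n))"]) (simp add: open_cyl)
  qed
  moreover have "range L = M"
  proof
    show "M \<subseteq> range L"
    proof
      fix x assume x: "x \<in> M"
      have "\<exists>n. d (c n) x < (1/4) * (1/2) ^ k" for k
        using near[OF x, of "(1/4) * (1/2) ^ k"] by simp
      then obtain \<alpha> where \<alpha>: "\<And>k. d (c (\<alpha> k)) x < (1/4) * (1/2) ^ k" by metis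
      \<comment> \<open>The factor \<open>1/4\<close> makes consecutive points so close that no move is ignored.\<close>
      have sc: "s \<alpha> k = c (\<alpha> k)" for k
      proof (induction k)
        case (Suc k)
        have "d (c (\<alpha> k)) (c (\<alpha> (Suc k))) \<le> d (c (\<alpha> k)) x + d (c (\<alpha> (Suc k))) x"
          using triangle' c x by blast
        also have "\<dots> < (1/2) ^ k"
          using \<alpha>[of k] \<alpha>[of "Suc k"] zero_less_power[of "1/2::real" k] unfolding power_Suc
          by linarith
        finally show ?case using Suc by (simp add: sS)
      qed (simp add: s0)
      have "d x (L \<alpha>) \<le> 0"
      proof (rule field_le_epsilon)
        fix e :: real assume "e > 0"
        then obtain n where n: "4 * (1/2) ^ n < e" using small by blast
        have "d x (L \<alpha>) \<le> d (s \<alpha> n) x + d (s \<alpha> n) (L \<alpha>)"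
          by (rule triangle''[OF x sM LM])
        then show "d x (L \<alpha>) \<le> 0 + e"
          using \<alpha>[of n] dL[of \<alpha> n] n zero_less_power[of "1/2::real" n] unfolding sc by linarith
      qed
      then have "x = L \<alpha>" using x LM mdist_pos_eq by (metis not_le)
      then show "x \<in> range L" by blast
    qed
  qed (use LM in auto)
  ultimately show ?thesis by blast
qed

text \<open>
  The normal form of analytic sets on which all later constructions operate: the parts of \<open>A\<close> that are
  parametrized by the cylinders of the Baire space can be followed along a tree.
\<close>

lemma analytic_in_iff_Baire_image:
  assumes "A \<noteq> {}"
  shows "analytic_in Z A \<longleftrightarrow>
    (\<exists>f :: (nat \<Rightarrow> nat) \<Rightarrow> _. continuous_map euclidean Z f \<and> range f = A)"
proof
  assume "analytic_in Z A"
  then obtain Y :: "(nat \<Rightarrow> nat) topology" and f where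
    Y: "Polish_space Y" "continuous_map Y Z f" "f ` topspace Y = A"
    unfolding analytic_in_def by blast
  obtain M d where Md: "Metric_space M d" "Metric_space.mcomplete M d" "Y = Metric_space.mtopology M d"
    using Y(1) unfolding Polish_space_def completely_metrizable_space_def by blast
  interpret Metric_space M d by fact
  obtain C where C: "countable C" "C \<subseteq> M" "mtopology closure_of C = M"
    using Y(1) unfolding Polish_space_def separable_space_def Md(3) by auto
  have "M \<noteq> {}" using assms Y(3) Md(3) by auto
  then obtain L where L: "continuous_map (euclidean :: (nat \<Rightarrow> nat) topology) mtopology L" "range L = M"
    using Baire_space_onto_complete[OF C Md(2)] by blast
  have "continuous_map euclidean Z (f \<circ> L)"
    by (rule continuous_map_compose[OF L(1) Y(2)[unfolded Md(3)]])
  moreover have "range (f \<circ> L) = A"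
    using L(2) Y(3) Md(3) image_comp[of f L UNIV] by simp
  ultimately show "\<exists>f :: (nat \<Rightarrow> nat) \<Rightarrow> _. continuous_map euclidean Z f \<and> range f = A" by blast
next
  assume "\<exists>f :: (nat \<Rightarrow> nat) \<Rightarrow> _. continuous_map euclidean Z f \<and> range f = A"
  then show "analytic_in Z A"
    using analytic_inI[OF Polish_space_Baire] by (metis topspace_euclidean)
qed

lemma analytic_in_empty: "analytic_in Z {}"
proof (rule analytic_inI)
  show "Polish_space (trivial_topology :: (nat \<Rightarrow> nat) topology)"
    unfolding Polish_space_def separable_space_def
    using empty_completely_metrizable_space by auto
qed auto

lemma analytic_in_image:
  assumes "analytic_in Z A" "continuous_map (subtopology Z A) W g"
  shows "analytic_in W (g ` A)"
proof -
  obtain Y :: "(nat \<Rightarrow> nat) topology" and f where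
    Y: "Polish_space Y" "continuous_map Y Z f" "f ` topspace Y = A"
    using assms(1) unfolding analytic_in_def by blast
  then have "continuous_map Y (subtopology Z A) f"
    by (auto simp: continuous_map_in_subtopology)
  then have "continuous_map Y W (g \<circ> f)"
    using assms(2) by (rule continuous_map_compose)
  with Y(1) show ?thesis
    by (rule analytic_inI) (metis Y(3) image_comp)
qed

lemma analytic_in_Int_closed:
  fixes Z :: "'a topology"
  assumes "analytic_in Z A" "closedin Z C"
  shows "analytic_in Z (A \<inter> C)"
proof (cases "A = {}")
  case False
  then obtain f :: "(nat \<Rightarrow> nat) \<Rightarrow> 'a" where f: "continuous_map euclidean Z f" "range f = A"
    using assms(1) analytic_in_iff_Baire_image[OF False, of Z] by blast
  have "closedin euclidean (f -` C)"
    using closedin_continuous_map_preimage[OF f(1) assms(2)] by (simp add: vimage_def)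
  then have "Polish_space (top_of_set (f -` C))"
    using Polish_space_closed_Baire by simp
  then show ?thesis
  proof (rule analytic_inI)
    show "continuous_map (top_of_set (f -` C)) Z f"
      using f(1) by (rule continuous_map_from_subtopology)
    show "f ` topspace (top_of_set (f -` C)) = A \<inter> C"
      using f(2) by auto
  qed
qed (simp add: analytic_in_empty)

text \<open>
  The first entry of a sequence selects one of the sets and the rest of it a point of that set.
\<close>

lemma analytic_in_UN:
  fixes Z :: "'a topology" and A :: "nat \<Rightarrow> 'a set"
  assumes "\<And>n. analytic_in Z (A n)"
  shows "analytic_in Z (\<Union>n. A n)"
proof (cases "\<exists>n. A n \<noteq> {}")
  case True
  then obtain n0 where n0: "A n0 \<noteq> {}" by blast
  \<comment> \<open>Empty sets have no parametrization; replacing them does not change the union.\<close>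
  define B where "B n = (if A n = {} then A n0 else A n)" for n
  have "\<exists>f :: (nat \<Rightarrow> nat) \<Rightarrow> 'a. continuous_map euclidean Z f \<and> range f = B n" for n
  proof -
    have "B n \<noteq> {}" "analytic_in Z (B n)" using assms n0 by (simp_all add: B_def)
    then show ?thesis by (rule analytic_in_iff_Baire_image[THEN iffD1])
  qed
  then obtain f :: "nat \<Rightarrow> (nat \<Rightarrow> nat) \<Rightarrow> 'a" where
    f: "\<And>n. continuous_map euclidean Z (f n)" "\<And>n. range (f n) = B n" by metis
  define g where "g \<alpha> = f (\<alpha> 0) (\<lambda>i. \<alpha> (Suc i))" for \<alpha> :: "nat \<Rightarrow> nat"
  have shift: "continuous_on UNIV (\<lambda>\<alpha> :: nat \<Rightarrow> nat. \<lambda>i. \<alpha> (Suc i))"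
    by (intro continuous_on_coordinatewise_then_product continuous_on_product_coordinates)
  have "continuous_map euclidean Z g"
    unfolding continuous_map_def
  proof (intro conjI allI impI)
    show "g \<in> topspace euclidean \<rightarrow> topspace Z"
      using f(1) by (simp add: g_def continuous_map_def Pi_iff)
    fix U assume U: "openin Z U"
    have eq: "{\<alpha> \<in> topspace euclidean. g \<alpha> \<in> U} =
      (\<Union>n. (\<lambda>\<alpha>. \<alpha> 0) -` {n} \<inter> (\<lambda>\<alpha> i. \<alpha> (Suc i)) -` {\<beta>. f n \<beta> \<in> U})"
      by (auto simp: g_def)
    have "open {\<beta>. f n \<beta> \<in> U}" for n
      using f(1)[of n] U by (auto simp: continuous_map_def)
    then have "open ((\<lambda>\<alpha> i. \<alpha> (Suc i)) -` {\<beta>. f n \<beta> \<in> U})" for n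
      by (rule open_vimage[OF _ shift])
    moreover have "open ((\<lambda>\<alpha>::nat \<Rightarrow> nat. \<alpha> 0) -` {n})" for n
      by (rule open_vimage[OF open_discrete]) simp
    ultimately show "openin euclidean {\<alpha> \<in> topspace euclidean. g \<alpha> \<in> U}"
      unfolding eq open_openin[symmetric] by (intro open_UN ballI open_Int)
  qed
  moreover have "range g = (\<Union>n. A n)"
  proof -
    have "f n \<beta> \<in> range g" for n \<beta>
      by (rule range_eqI[of _ _ "\<lambda>i. case i of 0 \<Rightarrow> n | Suc j \<Rightarrow> \<beta> j"]) (simp add: g_def)
    then have "range g = (\<Union>n. range (f n))" by (auto simp: g_def)
    also have "\<dots> = (\<Union>n. A n)" using n0 unfolding f(2) B_def by auto
    finally show ?thesis .
  qed
  ultimately show ?thesis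
    using analytic_inI[OF Polish_space_Baire] by simp
qed (simp add: analytic_in_empty)

lemma analytic_in_singleton: "x \<in> topspace Z \<Longrightarrow> analytic_in Z {x}"
  by (rule analytic_inI[OF Polish_space_Baire, of _ "\<lambda>_. x"]) auto

section \<open>Embedding zero-dimensional spaces in the Cantor space\<close>

lemma separable_metrizable_imp_second_countable:
  assumes "separable_space X" "metrizable_space X"
  shows "second_countable X"
proof -
  obtain M d where M: "Metric_space M d" and X: "X = Metric_space.mtopology M d"
    using assms(2) by (auto simp: metrizable_space_def)
  interpret Metric_space M d by fact
  obtain C where C: "countable C" "C \<subseteq> M" "X closure_of C = M"
    using assms(1) by (auto simp: separable_space_def X)
  define \<B> where "\<B> = (\<lambda>(c, n :: nat). mball c (inverse (Suc n))) ` (C \<times> UNIV)"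
  show ?thesis unfolding second_countable_def
  proof (intro exI conjI allI impI)
    show "countable \<B>" unfolding \<B>_def using C(1) by (intro countable_image countable_SIGMA) auto
    show "\<forall>V\<in>\<B>. openin X V" by (auto simp: \<B>_def X)
    fix U x assume U: "openin X U \<and> x \<in> U"
    then obtain r where r: "r > 0" "mball x r \<subseteq> U" and x: "x \<in> M"
      unfolding X openin_mtopology by blast
    obtain n where n: "inverse (real (Suc n)) < r / 2"
      using reals_Archimedean[of "r / 2"] r(1) by auto
    have "0 < inverse (real (Suc n))" by simp
    moreover have "x \<in> mtopology closure_of C" using C(3) X x by simp
    ultimately obtain c where c: "c \<in> C" "c \<in> mball x (inverse (real (Suc n)))"
      unfolding metric_closure_of by blast
    have cM: "c \<in> M" using c(1) C(2) by blast
    have "mball c (inverse (real (Suc n))) \<subseteq> mball x r"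
    proof
      fix y assume y: "y \<in> mball c (inverse (real (Suc n)))"
      have "d x y \<le> d x c + d c y" using triangle x cM y by (simp add: in_mball)
      then show "y \<in> mball x r" using c(2) y n x by (simp add: in_mball)
    qed
    moreover have "x \<in> mball c (inverse (real (Suc n)))"
      using c(2) x by (simp add: in_mball commute)
    moreover have "mball c (inverse (real (Suc n))) \<in> \<B>"
      unfolding \<B>_def using c(1) by (intro image_eqI[where x="(c, n)"]) auto
    ultimately show "\<exists>V\<in>\<B>. x \<in> V \<and> V \<subseteq> U" using r(2) by blast
  qed
qed

text \<open>
  The clopen base that witnesses zero-dimensionality may be uncountable. For each pair of members
  of a countable base choose, if possible, one clopen set between them; these sets still form a
  base.
\<close>

lemma countable_clopen_base:
  assumes "second_countable X" "zero_dimensional_space X"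
  shows "\<exists>\<V>. countable \<V> \<and> (\<forall>V\<in>\<V>. openin X V \<and> closedin X V) \<and>
     (\<forall>U x. openin X U \<and> x \<in> U \<longrightarrow> (\<exists>V\<in>\<V>. x \<in> V \<and> V \<subseteq> U))"
proof -
  obtain \<U> where \<U>: "countable \<U>" "\<And>U x. openin X U \<Longrightarrow> x \<in> U \<Longrightarrow> \<exists>V\<in>\<U>. x \<in> V \<and> V \<subseteq> U"
      "\<And>V. V \<in> \<U> \<Longrightarrow> openin X V"
    using assms(1) unfolding second_countable_def by metis
  obtain \<B> where \<B>: "\<And>V. V \<in> \<B> \<Longrightarrow> openin X V \<and> closedin X V"
      "\<And>U x. openin X U \<Longrightarrow> x \<in> U \<Longrightarrow> \<exists>V\<in>\<B>. x \<in> V \<and> V \<subseteq> U"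
    using assms(2) unfolding zero_dimensional_space_def by metis
  define P where "P p V \<longleftrightarrow> V \<in> \<B> \<and> fst p \<subseteq> V \<and> V \<subseteq> snd p" for p V
  define \<V> where "\<V> = (\<lambda>p. SOME V. P p V) ` {p \<in> \<U> \<times> \<U>. \<exists>V. P p V}"
  have P: "P p (SOME V. P p V)" if "\<exists>V. P p V" for p
    using that by (rule someI_ex)
  show ?thesis
  proof (intro exI conjI allI impI ballI)
    show "countable \<V>" unfolding \<V>_def
      by (intro countable_image countable_subset[OF _ countable_SIGMA[OF \<U>(1) \<U>(1)]]) auto
    show "openin X V" "closedin X V" if "V \<in> \<V>" for V
      using that P \<B>(1) unfolding \<V>_def P_def by blast+
    fix U x assume U: "openin X U \<and> x \<in> U"
    then obtain B where B: "B \<in> \<U>" "x \<in> B" "B \<subseteq> U" using \<U>(2) by blast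
    then obtain W where W: "W \<in> \<B>" "x \<in> W" "W \<subseteq> B" using \<U>(3) \<B>(2) by metis
    then obtain A where A: "A \<in> \<U>" "x \<in> A" "A \<subseteq> W" using \<U>(2) \<B>(1) by metis
    have ex: "\<exists>V. P (A, B) V" using W A by (auto simp: P_def)
    then have "(SOME V. P (A, B) V) \<in> \<V>" unfolding \<V>_def using A(1) B(1) by blast
    moreover have "x \<in> (SOME V. P (A, B) V)" "(SOME V. P (A, B) V) \<subseteq> U"
      using P[OF ex] A(2) B(3) unfolding P_def by auto
    ultimately show "\<exists>V\<in>\<V>. x \<in> V \<and> V \<subseteq> U" by blast
  qed
qed

text \<open>
  A point is determined, also topologically, by the members of a countable clopen base that
  contain it.
\<close>

lemma zero_dimensional_embeds_in_Cantor:
  assumes "separable_space X" "metrizable_space X" "zero_dimensional_space X"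
  shows "\<exists>e. embedding_map X (euclidean :: (nat \<Rightarrow> bool) topology) e"
proof -
  obtain \<V> where \<V>: "countable \<V>" "\<And>V. V \<in> \<V> \<Longrightarrow> openin X V \<and> closedin X V"
     "\<And>U x. openin X U \<Longrightarrow> x \<in> U \<Longrightarrow> \<exists>V\<in>\<V>. x \<in> V \<and> V \<subseteq> U"
    using countable_clopen_base[OF separable_metrizable_imp_second_countable[OF assms(1,2)] assms(3)]
    by metis
  \<comment> \<open>The empty set is added for the case that \<open>X\<close> is empty and so possibly \<open>\<V>\<close> too.\<close>
  define V where "V = from_nat_into (insert {} \<V>)"
  have rangeV: "range V = insert {} \<V>"
    unfolding V_def by (rule range_from_nat_into) (use \<V>(1) in auto)
  have V: "openin X (V i)" "closedin X (V i)" for i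
  proof -
    have "V i \<in> insert {} \<V>" using rangeV by blast
    then show "openin X (V i)" "closedin X (V i)" using \<V>(2) by auto
  qed
  have base: "\<exists>i. x \<in> V i \<and> V i \<subseteq> U" if U: "openin X U" "x \<in> U" for U x
  proof -
    obtain W where "W \<in> \<V>" "x \<in> W" "W \<subseteq> U" using \<V>(3)[OF U] by blast
    then show ?thesis using rangeV by (metis insertI2 rangeE)
  qed
  define e where "e x i \<longleftrightarrow> x \<in> V i" for x i
  have "continuous_map X euclidean (\<lambda>x. e x i)" for i
    unfolding continuous_map_def
  proof (intro conjI allI impI)
    fix U :: "bool set"
    have U: "b \<in> U \<longleftrightarrow> b \<and> True \<in> U \<or> \<not> b \<and> False \<in> U" for b
      by (cases b) auto
    have "{x \<in> topspace X. e x i \<in> U} =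
        {x \<in> topspace X. x \<in> V i \<and> True \<in> U \<or> x \<notin> V i \<and> False \<in> U}"
      by (subst U) (simp add: e_def)
    also have "\<dots> \<in> {{}, topspace X, V i, topspace X - V i}"
      using openin_subset[OF V(1)[of i]] by (cases "True \<in> U"; cases "False \<in> U") auto
    finally have "{x \<in> topspace X. e x i \<in> U} \<in> {{}, topspace X, V i, topspace X - V i}" .
    moreover have "\<forall>W\<in>{{}, topspace X, V i, topspace X - V i}. openin X W"
      using V[of i] by (auto intro: openin_diff)
    ultimately show "openin X {x \<in> topspace X. e x i \<in> U}" by (rule bspec[rotated])
  qed auto
  then have "continuous_map X (product_topology (\<lambda>_. euclidean) UNIV) e"
    by (subst continuous_map_componentwise_UNIV) blast
  then have "continuous_map X euclidean e" unfolding euclidean_product_topology .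
  then have cont: "continuous_map X (top_of_set (e ` topspace X)) e"
    by (auto simp: continuous_map_in_subtopology)
  have inj: "inj_on e (topspace X)"
  proof (rule inj_onI, rule ccontr)
    fix x y assume xy: "x \<in> topspace X" "y \<in> topspace X" "e x = e y" "x \<noteq> y"
    have "Hausdorff_space X" using assms(2) by (rule metrizable_imp_Hausdorff_space)
    then obtain U W where U: "openin X U" "openin X W" "x \<in> U" "y \<in> W" "disjnt U W"
      using xy unfolding Hausdorff_space_def by metis
    then obtain i where "x \<in> V i" "V i \<subseteq> U" using base by metis
    then have "e x i" "\<not> e y i" using U by (auto simp: e_def disjnt_iff)
    then show False using xy(3) by simp
  qed
  have "open_map X (top_of_set (e ` topspace X)) e"
    unfolding open_map_def
  proof (intro allI impI)
    fix U assume U: "openin X U"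
    have "e ` U = (e ` topspace X) \<inter> (\<Union>i\<in>{i. V i \<subseteq> U}. (\<lambda>z. z i) -` {True})"
    proof (intro equalityI subsetI)
      fix z assume "z \<in> e ` U"
      then obtain x where x: "x \<in> U" "z = e x" by blast
      then obtain i where "x \<in> V i" "V i \<subseteq> U" using base U by metis
      then show "z \<in> (e ` topspace X) \<inter> (\<Union>i\<in>{i. V i \<subseteq> U}. (\<lambda>z. z i) -` {True})"
        using x openin_subset[OF U] by (auto simp: e_def)
    next
      fix z assume "z \<in> (e ` topspace X) \<inter> (\<Union>i\<in>{i. V i \<subseteq> U}. (\<lambda>z. z i) -` {True})"
      then show "z \<in> e ` U" by (auto simp: e_def)
    qed
    moreover have "open ((\<lambda>z::nat \<Rightarrow> bool. z i) -` {True})" for i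
      by (rule open_vimage[OF open_discrete]) simp
    then have "open (\<Union>i\<in>{i. V i \<subseteq> U}. (\<lambda>z::nat \<Rightarrow> bool. z i) -` {True})" by blast
    ultimately show "openin (top_of_set (e ` topspace X)) (e ` U)"
      by (metis openin_open_Int)
  qed
  then have "homeomorphic_map X (top_of_set (e ` topspace X)) e"
    using cont inj by (intro bijective_open_imp_homeomorphic_map) auto
  then show ?thesis unfolding embedding_map_def by blast
qed

text \<open>
  Being the image of a Polish space does not depend on the space in which \<open>X\<close> is embedded. This
  permits working with continuous images inside \<open>X\<close> and inside the Cantor space instead of \<open>Z\<close>.
\<close>

lemma analytic_in_itself_if_embedded:
  assumes "Polish_space (Z :: (nat \<Rightarrow> nat) topology)" "embedding_map X Z j"
    "analytic_in Z (j ` topspace X)"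
  shows "analytic_in X (topspace X)"
proof -
  obtain k where k: "homeomorphic_maps X (subtopology Z (j ` topspace X)) j k"
    using assms(2) unfolding embedding_map_def homeomorphic_map_maps by blast
  then have "continuous_map (subtopology Z (j ` topspace X)) X k"
    by (simp add: homeomorphic_maps_def)
  from analytic_in_image[OF assms(3) this]
  have "analytic_in X (k ` (j ` topspace X))" .
  moreover have "k ` (j ` topspace X) = topspace X"
    using k by (force simp: homeomorphic_maps_def image_image)
  ultimately show ?thesis by simp
qed

section \<open>Sigma-ideals and schemes of cylinders\<close>

locale sigma_ideal =
  fixes J :: "'a set set"
  assumes subset: "A \<in> J \<Longrightarrow> B \<subseteq> A \<Longrightarrow> B \<in> J"
    and countable_Union: "countable \<A> \<Longrightarrow> \<A> \<subseteq> J \<Longrightarrow> \<Union>\<A> \<in> J"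
begin

lemma countable_UN:
  assumes "countable I" "\<And>i. i \<in> I \<Longrightarrow> A i \<in> J"
  shows "(\<Union>i\<in>I. A i) \<in> J"
  using countable_Union[of "A ` I"] assms by (metis countable_image image_subset_iff)

lemma Un: "A \<in> J \<Longrightarrow> B \<in> J \<Longrightarrow> A \<union> B \<in> J"
  using countable_Union[of "{A, B}"] by simp

end

lemma sigma_ideal_UNIV: "sigma_ideal UNIV"
  by unfold_locales auto

lemma prefix_nth: "prefix u v \<Longrightarrow> i < length u \<Longrightarrow> v ! i = u ! i"
  by (auto simp: prefix_def nth_append)

text \<open>
  Let \<open>w\<close> and \<open>t\<close> assign to every node of the tree of finite sequences a cylinder of the Cantor space and
  a cylinder of the Baire space, such that the image of the latter meets the former. Along a branch,
  the cylinders of the Baire space shrink to one point. By continuity its image lies in all cylinders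
  \<open>w\<close> of the branch, as these are closed. Disjointness of the cylinders \<open>w\<close> at each node
  makes the branch recoverable from that image.
\<close>

lemma scheme_embedding:
  fixes f :: "(nat \<Rightarrow> nat) \<Rightarrow> (nat \<Rightarrow> bool)"
    and w :: "nat list \<Rightarrow> bool list" and t :: "nat list \<Rightarrow> nat list"
  assumes f: "continuous_on UNIV f"
    and meet: "\<And>s. f ` cyl (t s) \<inter> cyl (w s) \<noteq> {}"
    and tS: "\<And>s n. \<exists>a. t (s @ [n]) = t s @ [a]"
    and wS: "\<And>s n. strict_prefix (w s) (w (s @ [n]))"
    and wd: "\<And>s m n. m \<noteq> n \<Longrightarrow> cyl (w (s @ [m])) \<inter> cyl (w (s @ [n])) = {}"
  shows "\<exists>g :: (nat \<Rightarrow> nat) \<Rightarrow> (nat \<Rightarrow> bool). emb UNIV g \<and> range g \<subseteq> range f \<and>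
    range g = {y. \<forall>k. \<exists>s. length s = k \<and> y \<in> cyl (w s)}"
proof -
  have lw: "length s \<le> length (w s)" for s
  proof (induction s rule: rev_induct)
    case (snoc n s)
    then show ?case using prefix_length_less[OF wS[of s n]] by simp
  qed simp
  define l where "l = length (t [])"
  have lt: "length (t s) = l + length s" for s
  proof (induction s rule: rev_induct)
    case (snoc n s)
    obtain a where "t (s @ [n]) = t s @ [a]" using tS by blast
    then show ?case using snoc by simp
  qed (simp add: l_def)
  have w_mono: "prefix (w (pre \<alpha> m)) (w (pre \<alpha> n))" if mn: "m \<le> n" for \<alpha> m n
    using mn
  proof (induction rule: dec_induct)
    case (step n)
    then show ?case
      using wS[of "pre \<alpha> n" "\<alpha> n"] by (metis pre_Suc prefix_order.trans strict_prefix_def)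
  qed simp
  have t_mono: "prefix (t (pre \<alpha> m)) (t (pre \<alpha> n))" if mn: "m \<le> n" for \<alpha> m n
    using mn
  proof (induction rule: dec_induct)
    case (step n)
    then show ?case
      using tS[of "pre \<alpha> n" "\<alpha> n"] by (metis pre_Suc prefix_order.trans prefixI)
  qed simp
  \<comment> \<open>The point of the Baire space to which the cylinders \<open>t\<close> shrink along the branch \<open>\<alpha>\<close>.\<close>
  define br where "br \<alpha> i = t (pre \<alpha> (Suc i)) ! i" for \<alpha> i
  have br: "br \<alpha> \<in> cyl (t (pre \<alpha> n))" for \<alpha> n
    unfolding in_cyl_iff
  proof (intro allI impI)
    fix i assume i: "i < length (t (pre \<alpha> n))"
    have i': "i < length (t (pre \<alpha> (Suc i)))" by (simp add: lt)
    show "br \<alpha> i = t (pre \<alpha> n) ! i"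
    proof (cases "n \<le> Suc i")
      case True
      from prefix_nth[OF t_mono[OF this] i] show ?thesis unfolding br_def .
    next
      case False
      then have "Suc i \<le> n" by simp
      from prefix_nth[OF t_mono[OF this] i'] show ?thesis unfolding br_def by simp
    qed
  qed
  define g where "g \<alpha> = f (br \<alpha>)" for \<alpha>
  have g: "g \<alpha> \<in> cyl (w (pre \<alpha> n))" for \<alpha> n
  proof -
    define L where "L = length (w (pre \<alpha> n))"
    obtain m where m: "\<And>\<beta>. pre \<beta> m = pre (br \<alpha>) m \<Longrightarrow> pre (f \<beta>) L = pre (f (br \<alpha>)) L"
      using f unfolding continuous_on_pre_iff by blast
    define k where "k = max m n"
    obtain \<beta> where \<beta>: "\<beta> \<in> cyl (t (pre \<alpha> k))" "f \<beta> \<in> cyl (w (pre \<alpha> k))"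
      using meet[of "pre \<alpha> k"] by blast
    have "m \<le> length (t (pre \<alpha> k))" by (simp add: lt k_def)
    moreover have "pre \<beta> (length (t (pre \<alpha> k))) = pre (br \<alpha>) (length (t (pre \<alpha> k)))"
      using in_cylD[OF \<beta>(1)] in_cylD[OF br[of \<alpha> k]] by simp
    ultimately have "pre \<beta> m = pre (br \<alpha>) m" using pre_eq_mono by blast
    from m[OF this] have "pre (g \<alpha>) L = pre (f \<beta>) L" unfolding g_def by (rule sym)
    moreover have "f \<beta> \<in> cyl (w (pre \<alpha> n))"
      using \<beta>(2) cyl_mono[OF w_mono[of n k \<alpha>]] by (auto simp: k_def)
    ultimately show ?thesis unfolding cyl_def L_def by simp
  qed
  have unique: "s = s'" if "length s = length s'" "y \<in> cyl (w s)" "y \<in> cyl (w s')" for s s' y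
    using that
  proof (induction s arbitrary: s' rule: rev_induct)
    case (snoc n s)
    then obtain r m where s': "s' = r @ [m]" by (cases s' rule: rev_cases) auto
    have "y \<in> cyl (w s)" "y \<in> cyl (w r)"
      using snoc.prems(2,3) cyl_mono wS unfolding s' strict_prefix_def by blast+
    then have "s = r" using snoc.IH snoc.prems(1) unfolding s' by simp
    moreover have "n = m"
      using wd[of n m s] snoc.prems(2,3) \<open>s = r\<close> unfolding s' by blast
    ultimately show ?case unfolding s' by simp
  qed simp
  have "emb UNIV g"
    unfolding emb_def
  proof (intro ballI allI conjI)
    fix \<alpha> n
    have "pre (g \<beta>) n = pre (g \<alpha>) n" if \<beta>: "pre \<beta> n = pre \<alpha> n" for \<beta>
    proof -
      have "pre (g \<beta>) (length (w (pre \<alpha> n))) = pre (g \<alpha>) (length (w (pre \<alpha> n)))"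
        using in_cylD[OF g[of \<alpha> n]] in_cylD[OF g[of \<beta> n]] unfolding \<beta> by simp
      then show ?thesis using pre_eq_mono lw[of "pre \<alpha> n"] by (metis length_pre)
    qed
    then show "\<exists>m. \<forall>\<beta>\<in>UNIV. pre \<beta> m = pre \<alpha> m \<longrightarrow> pre (g \<beta>) n = pre (g \<alpha>) n" by blast
    define L where "L = length (w (pre \<alpha> n))"
    have "pre \<beta> n = pre \<alpha> n" if "pre (g \<beta>) L = pre (g \<alpha>) L" for \<beta>
    proof (rule unique)
      show "g \<beta> \<in> cyl (w (pre \<alpha> n))" using in_cylD[OF g[of \<alpha> n]] that by (simp add: cyl_def L_def)
      show "g \<beta> \<in> cyl (w (pre \<beta> n))" by (rule g)
    qed simp
    then show "\<exists>m. \<forall>\<beta>\<in>UNIV. pre (g \<beta>) m = pre (g \<alpha>) m \<longrightarrow> pre \<beta> n = pre \<alpha> n" by blast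
  qed
  moreover have "range g \<subseteq> range f" by (auto simp: g_def)
  moreover have "range g = {y. \<forall>k. \<exists>s. length s = k \<and> y \<in> cyl (w s)}"
  proof (intro equalityI subsetI CollectI allI)
    fix y k assume "y \<in> range g"
    then obtain \<alpha> where y: "y = g \<alpha>" by blast
    show "\<exists>s. length s = k \<and> y \<in> cyl (w s)"
      unfolding y by (intro exI[of _ "pre \<alpha> k"] conjI g) simp
  next
    fix y assume "y \<in> {y. \<forall>k. \<exists>s. length s = k \<and> y \<in> cyl (w s)}"
    then obtain s where s: "\<And>k. length (s k) = k" "\<And>k. y \<in> cyl (w (s k))" by auto metis
    have sS: "s (Suc k) = s k @ [s (Suc k) ! k]" for k
    proof -
      have "s (Suc k) \<noteq> []" using s(1)[of "Suc k"] by auto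
      then obtain r n where r: "s (Suc k) = r @ [n]" by (metis append_butlast_last_id)
      then have "length r = k" using s(1)[of "Suc k"] by simp
      moreover have "y \<in> cyl (w r)"
        using s(2)[of "Suc k"] cyl_mono wS unfolding r strict_prefix_def by blast
      ultimately have "r = s k" using unique[of r "s k" y] s by simp
      then show ?thesis using r s(1)[of k] by (simp add: nth_append)
    qed
    define \<alpha> where "\<alpha> k = s (Suc k) ! k" for k
    have pre_s: "pre \<alpha> k = s k" for k
    proof (induction k)
      case 0
      then show ?case using s(1)[of 0] by simp
    next
      case (Suc k)
      then show ?case using sS[of k] by (simp add: pre_Suc \<alpha>_def)
    qed
    have "g \<alpha> = y"
    proof (rule eq_if_pre_eq)
      fix k
      have "pre (g \<alpha>) (length (w (s k))) = pre y (length (w (s k)))"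
        using in_cylD[OF g[of \<alpha> k]] in_cylD[OF s(2)[of k]] by (simp add: pre_s)
      then show "pre (g \<alpha>) k = pre y k" using pre_eq_mono lw[of "s k"] s(1) by metis
    qed
    then show "y \<in> range g" by blast
  qed
  ultimately show ?thesis by blast
qed

text \<open>
  The scheme grows from a root by one-step extensions that preserve an invariant \<open>Q\<close>. If every step
  misses only a set of \<open>J\<close> below its node, then all branches together miss only a set of \<open>J\<close>, since
  the tree has countably many nodes.
\<close>

lemma scheme_from_steps:
  fixes f :: "(nat \<Rightarrow> nat) \<Rightarrow> (nat \<Rightarrow> bool)" and J :: "(nat \<Rightarrow> bool) set set"
  assumes J: "sigma_ideal J"
    and f: "continuous_on UNIV f"
    and root: "Q ur vr"
    and meet: "\<And>u v. Q u v \<Longrightarrow> f ` cyl v \<inter> cyl u \<noteq> {}"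
    and step: "\<And>u v. Q u v \<Longrightarrow> \<exists>u' v'. (\<forall>n::nat. Q (u' n) (v' n) \<and> strict_prefix u (u' n) \<and>
        (\<exists>a. v' n = v @ [a])) \<and> (\<forall>m n. m \<noteq> n \<longrightarrow> cyl (u' m) \<inter> cyl (u' n) = {}) \<and>
        A \<inter> cyl u - (\<Union>n. cyl (u' n)) \<in> J"
  shows "\<exists>g :: (nat \<Rightarrow> nat) \<Rightarrow> (nat \<Rightarrow> bool). emb UNIV g \<and> range g \<subseteq> range f \<inter> cyl ur \<and>
    A \<inter> cyl ur - range g \<in> J"
proof -
  interpret sigma_ideal J by fact
  define R where "R u v p \<longleftrightarrow> (\<forall>n::nat. Q (fst p n) (snd p n) \<and> strict_prefix u (fst p n) \<and>
        (\<exists>a. snd p n = v @ [a])) \<and> (\<forall>m n. m \<noteq> n \<longrightarrow> cyl (fst p m) \<inter> cyl (fst p n) = {}) \<and>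
        A \<inter> cyl u - (\<Union>n. cyl (fst p n)) \<in> J" for u v p
  define U V where "U u v = fst (SOME p. R u v p)" and "V u v = snd (SOME p. R u v p)" for u v
  have R: "R u v (U u v, V u v)" if Q: "Q u v" for u v
  proof -
    have "\<exists>u' v'. R u v (u', v')" using step[OF Q] by (simp only: R_def fst_conv snd_conv)
    then obtain p where "R u v p" by blast
    then have "R u v (SOME p. R u v p)" by (rule someI)
    then show ?thesis by (simp add: U_def V_def)
  qed
  have UV: "Q (U u v n) (V u v n)" "strict_prefix u (U u v n)" "\<exists>a. V u v n = v @ [a]"
      "m \<noteq> n \<Longrightarrow> cyl (U u v m) \<inter> cyl (U u v n) = {}"
      "A \<inter> cyl u - (\<Union>n. cyl (U u v n)) \<in> J" if "Q u v" for u v m n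
    using R[OF that] unfolding R_def fst_conv snd_conv by blast+
  define st where "st = foldl (\<lambda>(u, v) n. (U u v n, V u v n)) (ur, vr)"
  define w t where "w s = fst (st s)" and "t s = snd (st s)" for s
  have w0: "w [] = ur" and t0: "t [] = vr" by (simp_all add: w_def t_def st_def)
  have wS: "w (s @ [n]) = U (w s) (t s) n" and tS: "t (s @ [n]) = V (w s) (t s) n" for s n
    by (simp_all add: w_def t_def st_def case_prod_beta)
  have Q: "Q (w s) (t s)" for s
    by (induction s rule: rev_induct) (simp_all add: w0 t0 root wS tS UV(1))
  have w_mono: "strict_prefix (w s) (w (s @ [n]))" for s n
    unfolding wS by (rule UV(2)[OF Q])
  obtain g :: "(nat \<Rightarrow> nat) \<Rightarrow> (nat \<Rightarrow> bool)" where
    g: "emb UNIV g" "range g \<subseteq> range f" "range g = {y. \<forall>k. \<exists>s. length s = k \<and> y \<in> cyl (w s)}"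
  proof -
    have "\<exists>g :: (nat \<Rightarrow> nat) \<Rightarrow> (nat \<Rightarrow> bool). emb UNIV g \<and> range g \<subseteq> range f \<and>
      range g = {y. \<forall>k. \<exists>s. length s = k \<and> y \<in> cyl (w s)}"
    proof (rule scheme_embedding[OF f])
      show "f ` cyl (t s) \<inter> cyl (w s) \<noteq> {}" for s by (rule meet[OF Q])
      show "\<exists>a. t (s @ [n]) = t s @ [a]" for s n unfolding tS by (rule UV(3)[OF Q])
      show "strict_prefix (w s) (w (s @ [n]))" for s n by (rule w_mono)
      show "cyl (w (s @ [m])) \<inter> cyl (w (s @ [n])) = {}" if "m \<noteq> n" for s m n
        unfolding wS by (rule UV(4)[OF Q that])
    qed
    then show ?thesis using that by blast
  qed
  have "range g \<subseteq> cyl ur"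
  proof
    fix y assume "y \<in> range g"
    then obtain s where "length s = 0" "y \<in> cyl (w s)" unfolding g(3) by blast
    then show "y \<in> cyl ur" using w0 by simp
  qed
  moreover have "A \<inter> cyl ur - range g \<subseteq> (\<Union>s. A \<inter> cyl (w s) - (\<Union>n. cyl (w (s @ [n]))))"
  proof
    fix y assume y: "y \<in> A \<inter> cyl ur - range g"
    show "y \<in> (\<Union>s. A \<inter> cyl (w s) - (\<Union>n. cyl (w (s @ [n]))))"
    proof (rule ccontr)
      assume no: "y \<notin> (\<Union>s. A \<inter> cyl (w s) - (\<Union>n. cyl (w (s @ [n]))))"
      have "\<exists>s. length s = k \<and> y \<in> cyl (w s)" for k
      proof (induction k)
        case 0
        show ?case using y w0 by (intro exI[of _ "[]"]) simp
      next
        case (Suc k)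
        then obtain s where s: "length s = k" "y \<in> cyl (w s)" by blast
        then obtain n where "y \<in> cyl (w (s @ [n]))" using no y by blast
        then show ?case using s(1) by (intro exI[of _ "s @ [n]"]) simp
      qed
      then show False using y g(3) by blast
    qed
  qed
  moreover have "(\<Union>s. A \<inter> cyl (w s) - (\<Union>n. cyl (w (s @ [n])))) \<in> J"
    unfolding wS by (intro countable_UN UV(5) Q) simp
  ultimately show ?thesis using g(1,2) subset by (intro exI[of _ g]) blast
qed

lemma image_cyl_split: "f ` cyl v = (\<Union>a. f ` cyl (v @ [a]))" for f :: "(nat \<Rightarrow> nat) \<Rightarrow> 'b"
proof -
  have "x \<in> cyl (v @ [x (length v)])" if "x \<in> cyl v" for x :: "nat \<Rightarrow> nat"
    using that by (simp add: cyl_def pre_Suc)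
  moreover have "cyl (v @ [a]) \<subseteq> cyl v" for a by (rule cyl_mono) simp
  ultimately show ?thesis by blast
qed

text \<open>
  The invariant is that the image of the cylinder in the Baire space is uncountable inside the
  cylinder in the Cantor space. Around a condensation point of such a set there are infinitely many
  rings in which it is uncountable.
\<close>

lemma perfect_set:
  fixes A :: "(nat \<Rightarrow> bool) set"
  assumes A: "analytic_in euclidean A" and unc: "uncountable (A \<inter> cyl u)"
  shows "\<exists>g :: (nat \<Rightarrow> nat) \<Rightarrow> (nat \<Rightarrow> bool). emb UNIV g \<and> range g \<subseteq> A \<inter> cyl u"
proof -
  have "A \<noteq> {}" using unc by auto
  then obtain f :: "(nat \<Rightarrow> nat) \<Rightarrow> (nat \<Rightarrow> bool)" where f: "continuous_on UNIV f" "range f = A"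
    using A analytic_in_iff_Baire_image[of A] by auto
  define Q where "Q u v \<longleftrightarrow> uncountable (f ` cyl v \<inter> cyl u)" for u v
  have "\<exists>g :: (nat \<Rightarrow> nat) \<Rightarrow> (nat \<Rightarrow> bool). emb UNIV g \<and> range g \<subseteq> range f \<inter> cyl u \<and>
    A \<inter> cyl u - range g \<in> UNIV"
  proof (rule scheme_from_steps[where Q=Q and vr="[]", OF sigma_ideal_UNIV f(1)])
    show "Q u []" using unc f(2) by (simp add: Q_def)
    show "f ` cyl v \<inter> cyl u \<noteq> {}" if "Q u v" for u v using that unfolding Q_def by force
    fix u v assume "Q u v"
    define B where "B = f ` cyl v \<inter> cyl u"
    have B: "uncountable B" using \<open>Q u v\<close> by (simp add: Q_def B_def)
    \<comment> \<open>\<open>p\<close> is a condensation point of \<open>B\<close>.\<close>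
    define small where "small = {v. countable (B \<inter> cyl v)}"
    have "countable (\<Union>v\<in>small. B \<inter> cyl v)"
      by (intro countable_UN) (auto simp: small_def)
    then have "\<not> B \<subseteq> (\<Union>v\<in>small. B \<inter> cyl v)" using B countable_subset by blast
    then obtain p where p: "p \<in> B" "\<And>v. p \<in> cyl v \<Longrightarrow> uncountable (B \<inter> cyl v)"
      unfolding small_def by blast
    \<comment> \<open>\<open>ring n\<close> consists of the sequences that differ from \<open>p\<close> for the first time at \<open>n\<close>.\<close>
    define ring where "ring n = pre p n @ [\<not> p n]" for n
    have ring_disj: "cyl (ring m) \<inter> cyl (ring n) = {}" if mn: "m < n" for m n
    proof -
      have False if y: "y \<in> cyl (ring m)" "y \<in> cyl (ring n)" for y
      proof -
        have "y m = (\<not> p m)" using y(1) unfolding in_cyl_iff ring_def by (simp add: nth_append)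
        moreover have "pre y n = pre p n"
          using in_cylD[OF y(2)] by (simp add: ring_def pre_Suc)
        then have "y m = p m" using mn by (simp add: pre_eq_iff)
        ultimately show False by simp
      qed
      then show ?thesis by blast
    qed
    have ring_cover: "cyl (pre p m) \<subseteq> {p} \<union> (\<Union>n\<in>{m..}. cyl (ring n))" for m
    proof
      fix y assume y: "y \<in> cyl (pre p m)"
      show "y \<in> {p} \<union> (\<Union>n\<in>{m..}. cyl (ring n))"
      proof (cases "y = p")
        case False
        then have ex: "\<exists>n. y n \<noteq> p n" by auto
        define n where "n = (LEAST n. y n \<noteq> p n)"
        have n: "y n \<noteq> p n" unfolding n_def using ex by (rule LeastI_ex)
        have lt: "y i = p i" if "i < n" for i using not_less_Least that unfolding n_def by blast
        have "m \<le> n" using y n by (force simp: pre_eq_iff not_less[symmetric])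
        moreover have "y \<in> cyl (ring n)" using n lt by (auto simp: ring_def cyl_def pre_Suc pre_eq_iff)
        ultimately show ?thesis by auto
      qed simp
    qed
    define I where "I = {n. length u \<le> n \<and> uncountable (B \<inter> cyl (ring n))}"
    have "infinite I"
    proof
      assume "finite I"
      then obtain m0 where m0: "\<forall>n\<in>I. n < m0" using finite_nat_set_iff_bounded by blast
      define m where "m = max m0 (length u)"
      have "countable (B \<inter> cyl (ring n))" if "n \<in> {m..}" for n
        using m0 that by (force simp: I_def m_def)
      then have "countable (\<Union>n\<in>{m..}. B \<inter> cyl (ring n))"
        by (intro countable_UN) simp_all
      then have "countable ({p} \<union> (\<Union>n\<in>{m..}. B \<inter> cyl (ring n)))"
        unfolding countable_Un_iff by simp
      moreover have "B \<inter> cyl (pre p m) \<subseteq> {p} \<union> (\<Union>n\<in>{m..}. B \<inter> cyl (ring n))"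
        using ring_cover[of m] by blast
      ultimately have "countable (B \<inter> cyl (pre p m))" by (rule countable_subset[rotated])
      then show False using p(2)[of "pre p m"] by simp
    qed
    define k where "k = enumerate I"
    have k: "k n \<in> I" "strict_mono k" for n
      using \<open>infinite I\<close> unfolding k_def by (auto simp: enumerate_in_set strict_mono_enumerate)
    have pu: "pre p (length u) = u" using p(1) by (simp add: B_def cyl_def)
    have u: "strict_prefix u (ring (k n))" for n
    proof -
      have "prefix u (pre p (k n))" using k(1)[of n] prefix_pre[of "length u" "k n" p]
        unfolding pu by (simp add: I_def)
      then show ?thesis unfolding ring_def by (metis prefix_snoc strict_prefix_def prefix_order.eq_iff
            append_self_conv not_Cons_self2 prefix_length_le length_append_singleton not_less_eq_eq le_refl)
    qed
    have "\<exists>a. Q (ring (k n)) (v @ [a])" for n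
    proof (rule ccontr)
      assume "\<nexists>a. Q (ring (k n)) (v @ [a])"
      then have "countable (\<Union>a. f ` cyl (v @ [a]) \<inter> cyl (ring (k n)))"
        by (intro countable_UN) (simp_all add: Q_def)
      moreover have "B \<inter> cyl (ring (k n)) \<subseteq> (\<Union>a. f ` cyl (v @ [a]) \<inter> cyl (ring (k n)))"
        unfolding B_def image_cyl_split[of f v] by blast
      ultimately have "countable (B \<inter> cyl (ring (k n)))" by (rule countable_subset[rotated])
      then show False using k(1)[of n] by (simp add: I_def)
    qed
    then obtain a where a: "\<And>n. Q (ring (k n)) (v @ [a n])" by metis
    have disj: "cyl (ring (k m)) \<inter> cyl (ring (k n)) = {}" if "m \<noteq> n" for m n
    proof (cases "m < n")
      case True
      then show ?thesis using ring_disj strict_monoD[OF k(2)] by blast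
    next
      case False
      then have "n < m" using that by simp
      then show ?thesis using ring_disj strict_monoD[OF k(2)] by blast
    qed
    show "\<exists>u' v'. (\<forall>n::nat. Q (u' n) (v' n) \<and> strict_prefix u (u' n) \<and>
        (\<exists>a. v' n = v @ [a])) \<and> (\<forall>m n. m \<noteq> n \<longrightarrow> cyl (u' m) \<inter> cyl (u' n) = {}) \<and>
        A \<inter> cyl u - (\<Union>n. cyl (u' n)) \<in> UNIV"
      by (intro exI[of _ "\<lambda>n. ring (k n)"] exI[of _ "\<lambda>n. v @ [a n]"]) (use a u disj in auto)
  qed
  then show ?thesis using f(2) by blast
qed

section \<open>A homogeneous group around an analytic set\<close>

text \<open>
  The point evaluation at \<open>x\<close>: cylinders are numbered by natural numbers, and a cylinder is mapped to
  \<open>True\<close> iff it contains \<open>x\<close>.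
\<close>

definition eval_at :: "(nat \<Rightarrow> bool) \<Rightarrow> (nat \<Rightarrow> bool)" where
  "eval_at x i \<longleftrightarrow> x \<in> cyl (from_nat i)"

text \<open>
  The sum, modulo 2, of the point evaluations at the entries of a list.
\<close>

definition sum_eval :: "(nat \<Rightarrow> bool) list \<Rightarrow> (nat \<Rightarrow> bool)" where
  "sum_eval xs i \<longleftrightarrow> odd (length (filter (\<lambda>x. eval_at x i) xs))"

definition Boolean_span :: "(nat \<Rightarrow> bool) set \<Rightarrow> (nat \<Rightarrow> bool) set" where
  "Boolean_span N = sum_eval ` lists N"

lemma sum_eval_Nil: "sum_eval [] i \<longleftrightarrow> False"
  by (simp add: sum_eval_def)

lemma sum_eval_Cons: "sum_eval (x # xs) i \<longleftrightarrow> eval_at x i \<noteq> sum_eval xs i"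
  by (auto simp: sum_eval_def)

lemma sum_eval_append: "sum_eval (xs @ ys) i \<longleftrightarrow> sum_eval xs i \<noteq> sum_eval ys i"
  by (auto simp: sum_eval_def)

lemma eval_at_to_nat [simp]: "eval_at x (to_nat u) \<longleftrightarrow> x \<in> cyl u"
  by (simp add: eval_at_def)

lemma eval_at_in_Boolean_span: "x \<in> N \<Longrightarrow> eval_at x \<in> Boolean_span N"
proof -
  assume "x \<in> N"
  moreover have "eval_at x = sum_eval [x]" by (simp add: fun_eq_iff sum_eval_Cons sum_eval_Nil)
  ultimately show ?thesis unfolding Boolean_span_def by auto
qed

lemma Boolean_span_xor:
  assumes "g \<in> Boolean_span N" "h \<in> Boolean_span N"
  shows "(\<lambda>i. g i \<noteq> h i) \<in> Boolean_span N"
proof -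
  obtain xs ys where xy: "xs \<in> lists N" "g = sum_eval xs" "ys \<in> lists N" "h = sum_eval ys"
    using assms unfolding Boolean_span_def by blast
  then have "(\<lambda>i. g i \<noteq> h i) = sum_eval (xs @ ys)" by (simp add: fun_eq_iff sum_eval_append)
  moreover have "xs @ ys \<in> lists N" using xy by simp
  ultimately show ?thesis unfolding Boolean_span_def by blast
qed

text \<open>
  A set closed under addition modulo 2 is a subgroup of the Cantor group, and translations of
  a topological group are homeomorphisms that act transitively.
\<close>

lemma homogeneous_if_xor_closed:
  fixes H :: "(nat \<Rightarrow> bool) set"
  assumes xor: "\<And>g h. g \<in> H \<Longrightarrow> h \<in> H \<Longrightarrow> (\<lambda>i. g i \<noteq> h i) \<in> H"
  shows "homogeneous_space (top_of_set H)"
  unfolding homogeneous_space_def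
proof (intro ballI)
  fix x y assume "x \<in> topspace (top_of_set H)" "y \<in> topspace (top_of_set H)"
  then have xy: "x \<in> H" "y \<in> H" by auto
  define c where "c i \<longleftrightarrow> x i \<noteq> y i" for i
  define t where "t z i \<longleftrightarrow> z i \<noteq> c i" for z i
  have c: "c \<in> H" unfolding c_def[abs_def] using xor xy by blast
  have tH: "t z \<in> H" if "z \<in> H" for z unfolding t_def[abs_def] using xor that c by blast
  have tt: "t (t z) = z" for z by (auto simp: t_def fun_eq_iff)
  have "continuous_on H t"
    unfolding continuous_on_pre_iff
  proof (intro ballI allI)
    fix z n assume "z \<in> H"
    have "pre (t w) n = pre (t z) n" if "pre w n = pre z n" for w
      using that by (simp add: pre_eq_iff t_def)
    then show "\<exists>m. \<forall>w\<in>H. pre w m = pre z m \<longrightarrow> pre (t w) n = pre (t z) n" by blast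
  qed
  then have "homeomorphic_maps (top_of_set H) (top_of_set H) t t"
    using tH tt by (auto simp: homeomorphic_maps_def continuous_map_in_subtopology)
  then have "homeomorphic_map (top_of_set H) (top_of_set H) t"
    using homeomorphic_maps_map by blast
  moreover have "t x = y" by (auto simp: t_def c_def fun_eq_iff)
  ultimately show "\<exists>h. homeomorphic_map (top_of_set H) (top_of_set H) h \<and> h x = y" by blast
qed

lemma homogeneous_Boolean_span: "homogeneous_space (top_of_set (Boolean_span N))"
  by (rule homogeneous_if_xor_closed) (rule Boolean_span_xor)

text \<open>
  A finite part of \<open>eval_at x\<close> depends on an initial segment of \<open>x\<close>, and conversely an initial segment
  of \<open>x\<close> can be read off from the value of \<open>eval_at x\<close> at the cylinder with that segment.
\<close>

lemma emb_eval_at: "emb S eval_at"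
  unfolding emb_def
proof (intro ballI allI conjI)
  fix x :: "nat \<Rightarrow> bool" and n assume "x \<in> S"
  define m where "m = Max (insert 0 ((\<lambda>i. length (from_nat i :: bool list)) ` {..<n}))"
  have m: "length (from_nat i :: bool list) \<le> m" if "i < n" for i
    unfolding m_def using that by (intro Max_ge) auto
  have "pre (eval_at y) n = pre (eval_at x) n" if y: "pre y m = pre x m" for y
    unfolding pre_eq_iff
  proof (intro allI impI)
    fix i assume "i < n"
    then have "pre y (length (from_nat i :: bool list)) = pre x (length (from_nat i :: bool list))"
      using pre_eq_mono[OF y m] by blast
    then show "eval_at y i = eval_at x i" by (simp add: eval_at_def cyl_def)
  qed
  then show "\<exists>m. \<forall>y\<in>S. pre y m = pre x m \<longrightarrow> pre (eval_at y) n = pre (eval_at x) n" by blast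
  have "pre y n = pre x n"
    if y: "pre (eval_at y) (Suc (to_nat (pre x n))) = pre (eval_at x) (Suc (to_nat (pre x n)))" for y
  proof -
    have "eval_at y (to_nat (pre x n)) = eval_at x (to_nat (pre x n))"
      by (rule y[unfolded pre_eq_iff, rule_format, OF lessI])
    then show ?thesis by (simp only: eval_at_to_nat in_cyl_pre simp_thms)
  qed
  then show "\<exists>m. \<forall>y\<in>S. pre (eval_at y) m = pre (eval_at x) m \<longrightarrow> pre y n = pre x n" by blast
qed

text \<open>
  Two equal summands cancel.
\<close>

lemma sum_eval_of_distinct:
  assumes "xs \<in> lists N"
  shows "\<exists>ys. ys \<in> lists N \<and> distinct ys \<and> sum_eval ys = sum_eval xs"
  using assms
proof (induction xs rule: length_induct)
  case (1 xs)
  show ?case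
  proof (cases "distinct xs")
    case False
    then obtain as bs cs x where xs: "xs = as @ [x] @ bs @ [x] @ cs"
      using not_distinct_decomp by blast
    have eq: "sum_eval (as @ bs @ cs) = sum_eval xs"
      unfolding xs by (auto simp: fun_eq_iff sum_eval_append sum_eval_Cons sum_eval_Nil)
    have "length (as @ bs @ cs) < length xs" "as @ bs @ cs \<in> lists N"
      using "1.prems" unfolding xs by auto
    then obtain ys where "ys \<in> lists N" "distinct ys" "sum_eval ys = sum_eval (as @ bs @ cs)"
      using "1.IH" by blast
    then show ?thesis using eq by auto
  qed (use 1 in blast)
qed

lemma separating_length:
  fixes F :: "(nat \<Rightarrow> 'a) set"
  assumes "finite F"
  shows "\<exists>n. \<forall>x\<in>F. \<forall>y\<in>F. pre x n = pre y n \<longrightarrow> x = y"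
proof -
  have "\<exists>n. x \<noteq> y \<longrightarrow> pre x n \<noteq> pre y n" for x y :: "nat \<Rightarrow> 'a"
    using eq_if_pre_eq[of x y] by blast
  then obtain k where k: "\<And>x y :: nat \<Rightarrow> 'a. x \<noteq> y \<Longrightarrow> pre x (k x y) \<noteq> pre y (k x y)"
    by metis
  define n where "n = Max (insert 0 ((\<lambda>(x, y). k x y) ` (F \<times> F)))"
  have n: "k x y \<le> n" if "x \<in> F" "y \<in> F" for x y
    unfolding n_def using that assms by (intro Max_ge) auto
  show ?thesis
  proof (intro exI ballI impI)
    fix x y assume "x \<in> F" "y \<in> F" "pre x n = pre y n"
    then show "x = y" using k[of x y] n[of x y] pre_eq_mono[of x n y "k x y"] by blast
  qed
qed

lemma sum_eval_distinct_cyl: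
  assumes d: "distinct xs" and n: "\<forall>x\<in>set xs. \<forall>y\<in>set xs. pre x n = pre y n \<longrightarrow> x = y" and x: "x \<in> set xs"
  shows "sum_eval xs (to_nat (pre x n))"
proof -
  have "filter (\<lambda>y. eval_at y (to_nat (pre x n))) xs = filter (\<lambda>y. y = x) xs"
    using n x by (intro filter_cong) auto
  moreover have "length (filter (\<lambda>y. y = x) xs) = 1"
    using d x by (induction xs) (auto simp: filter_empty_conv)
  ultimately show ?thesis by (simp add: sum_eval_def)
qed

text \<open>
  Finitely many coordinates show that a sum \<open>h\<close> of distinct point evaluations is not a single one,
  nor close to one. If the number of summands is even, then \<open>h\<close> vanishes at the whole space, but no
  evaluation does. If it is odd and at least 3, then \<open>h\<close> is \<open>True\<close> at two disjoint cylinders, each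
  containing exactly one of the points, but no evaluation is.
\<close>

lemma eval_at_closed_in_Boolean_span:
  assumes "h \<in> Boolean_span N" "h \<notin> eval_at ` N"
  shows "\<exists>n. cyl (pre h n) \<inter> eval_at ` N = {}"
proof -
  obtain ys where ys: "ys \<in> lists N" "h = sum_eval ys"
    using assms(1) unfolding Boolean_span_def by blast
  obtain xs where xs: "xs \<in> lists N" "distinct xs" "h = sum_eval xs"
    using sum_eval_of_distinct[OF ys(1)] ys(2) by metis
  obtain I where I: "finite I" "\<And>x. x \<in> N \<Longrightarrow> \<exists>i\<in>I. eval_at x i \<noteq> h i"
  proof (cases "even (length xs)")
    case True
    have "filter (\<lambda>x. eval_at x (to_nat ([] :: bool list))) xs = xs"
      by (rule filter_True) simp
    then have "\<not> h (to_nat ([] :: bool list))"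
      unfolding xs(3) sum_eval_def using True by simp
    then show ?thesis
      by (intro that[of "{to_nat ([] :: bool list)}"]) auto
  next
    case False
    have "length xs \<noteq> 1"
    proof
      assume "length xs = 1"
      then obtain x where "xs = [x]" by (auto simp: length_Suc_conv)
      then have "h = eval_at x" "x \<in> N"
        using xs by (auto simp: fun_eq_iff sum_eval_Cons sum_eval_Nil)
      then show False using assms(2) by blast
    qed
    moreover have "length xs \<noteq> 0" using False by (metis even_zero)
    ultimately have "length xs \<ge> 2" by linarith
    then have l: "0 < length xs" "1 < length xs" by linarith+
    have xy: "xs ! 0 \<in> set xs" "xs ! 1 \<in> set xs" "xs ! 0 \<noteq> xs ! 1"
      using nth_mem[OF l(1)] nth_mem[OF l(2)] nth_eq_iff_index_eq[OF xs(2) l] by simp_all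
    obtain n where n: "\<forall>x\<in>set xs. \<forall>y\<in>set xs. pre x n = pre y n \<longrightarrow> x = y"
      using separating_length[of "set xs"] by auto
    define i j where "i = to_nat (pre (xs ! 0) n)" and "j = to_nat (pre (xs ! 1) n)"
    have "h i" "h j"
      unfolding xs(3) i_def j_def using sum_eval_distinct_cyl[OF xs(2) n] xy by blast+
    moreover have "\<not> (eval_at x i \<and> eval_at x j)" for x
      unfolding i_def j_def using n xy by (metis eval_at_to_nat in_cyl_pre)
    ultimately show ?thesis by (intro that[of "{i, j}"]) auto
  qed
  obtain n where n: "\<forall>i\<in>I. i < n" using I(1) finite_nat_set_iff_bounded by blast
  have "y \<notin> eval_at ` N" if y: "pre y n = pre h n" for y
  proof
    assume "y \<in> eval_at ` N"
    then obtain x i where "x \<in> N" "y = eval_at x" "i \<in> I" "eval_at x i \<noteq> h i" using I(2) by blast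
    moreover then have "y i = h i" using y n unfolding pre_eq_iff by blast
    ultimately show False by simp
  qed
  then have "cyl (pre h n) \<inter> eval_at ` N = {}" by (simp add: disjoint_iff)
  then show ?thesis by blast
qed

text \<open>
  The even and the odd entries of one sequence parametrize the two summands independently.
\<close>

lemma analytic_in_xor_image:
  fixes A B :: "(nat \<Rightarrow> bool) set"
  assumes "analytic_in euclidean A" "analytic_in euclidean B"
  shows "analytic_in euclidean ((\<lambda>(g, h) i. g i \<noteq> h i) ` (A \<times> B))"
proof (cases "A = {} \<or> B = {}")
  case False
  then obtain a b :: "(nat \<Rightarrow> nat) \<Rightarrow> (nat \<Rightarrow> bool)" where
    a: "continuous_on UNIV a" "range a = A" and b: "continuous_on UNIV b" "range b = B"
    using assms analytic_in_iff_Baire_image[of A] analytic_in_iff_Baire_image[of B] by auto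
  define l r :: "(nat \<Rightarrow> nat) \<Rightarrow> nat \<Rightarrow> nat" where
    "l \<alpha> i = \<alpha> (2 * i)" and "r \<alpha> i = \<alpha> (2 * i + 1)" for \<alpha> i
  have l: "continuous_on UNIV l" and r: "continuous_on UNIV r"
    unfolding l_def[abs_def] r_def[abs_def]
    by (intro continuous_on_coordinatewise_then_product continuous_on_product_coordinates)+
  define f where "f \<alpha> i \<longleftrightarrow> a (l \<alpha>) i \<noteq> b (r \<alpha>) i" for \<alpha> i
  have al: "continuous_on UNIV (\<lambda>\<alpha>. a (l \<alpha>))" and br: "continuous_on UNIV (\<lambda>\<alpha>. b (r \<alpha>))"
    using continuous_on_compose2[OF a(1) l] continuous_on_compose2[OF b(1) r] by auto
  have "continuous_on UNIV f"
    unfolding continuous_on_pre_iff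
  proof (intro ballI allI)
    fix \<alpha> n
    obtain m1 where m1: "\<And>\<beta>. pre \<beta> m1 = pre \<alpha> m1 \<Longrightarrow> pre (a (l \<beta>)) n = pre (a (l \<alpha>)) n"
      using al unfolding continuous_on_pre_iff by blast
    obtain m2 where m2: "\<And>\<beta>. pre \<beta> m2 = pre \<alpha> m2 \<Longrightarrow> pre (b (r \<beta>)) n = pre (b (r \<alpha>)) n"
      using br unfolding continuous_on_pre_iff by blast
    have "pre (f \<beta>) n = pre (f \<alpha>) n" if \<beta>: "pre \<beta> (max m1 m2) = pre \<alpha> (max m1 m2)" for \<beta>
    proof -
      have "pre (a (l \<beta>)) n = pre (a (l \<alpha>)) n" "pre (b (r \<beta>)) n = pre (b (r \<alpha>)) n"
        by (rule m1[OF pre_eq_mono[OF \<beta> max.cobounded1]], rule m2[OF pre_eq_mono[OF \<beta> max.cobounded2]])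
      then show ?thesis by (simp add: pre_eq_iff f_def)
    qed
    then show "\<exists>m. \<forall>\<beta>\<in>UNIV. pre \<beta> m = pre \<alpha> m \<longrightarrow> pre (f \<beta>) n = pre (f \<alpha>) n" by blast
  qed
  moreover have "range f = (\<lambda>(g, h) i. g i \<noteq> h i) ` (A \<times> B)"
  proof (intro equalityI subsetI)
    fix z assume "z \<in> range f"
    then obtain \<alpha> where "z = f \<alpha>" by blast
    moreover have "f \<alpha> = (\<lambda>i. a (l \<alpha>) i \<noteq> b (r \<alpha>) i)" by (simp add: f_def fun_eq_iff)
    ultimately show "z \<in> (\<lambda>(g, h) i. g i \<noteq> h i) ` (A \<times> B)"
      using a(2) b(2) by (intro image_eqI[of _ _ "(a (l \<alpha>), b (r \<alpha>))"]) auto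
  next
    fix z assume "z \<in> (\<lambda>(g, h) i. g i \<noteq> h i) ` (A \<times> B)"
    then obtain \<beta> \<gamma> where z: "z = (\<lambda>i. a \<beta> i \<noteq> b \<gamma> i)" using a(2) b(2) by auto
    define \<alpha> where "\<alpha> i = (if even i then \<beta> (i div 2) else \<gamma> (i div 2))" for i
    have lr: "l \<alpha> = \<beta>" "r \<alpha> = \<gamma>" by (simp_all add: l_def r_def \<alpha>_def fun_eq_iff)
    have "z = f \<alpha>" unfolding z f_def[abs_def] lr by (rule refl)
    then show "z \<in> range f" by blast
  qed
  ultimately show ?thesis
    by (intro analytic_inI[OF Polish_space_Baire, of _ f]) auto
qed (auto simp: analytic_in_empty)

lemma analytic_Boolean_span:
  assumes N: "analytic_in euclidean N"
  shows "analytic_in euclidean (Boolean_span N)"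
proof -
  define H where "H k = sum_eval ` {xs \<in> lists N. length xs = k}" for k
  have E: "analytic_in euclidean (eval_at ` N)"
    using analytic_in_image[OF N, of euclidean eval_at] emb_imp_continuous_on[OF emb_eval_at] by simp
  have "analytic_in euclidean (H k)" for k
  proof (induction k)
    case 0
    have "H 0 = {sum_eval []}" by (auto simp: H_def)
    then show ?case by (simp add: analytic_in_singleton)
  next
    case (Suc k)
    have "H (Suc k) = (\<lambda>(g, h) i. g i \<noteq> h i) ` (eval_at ` N \<times> H k)"
    proof (intro equalityI subsetI)
      fix z assume "z \<in> H (Suc k)"
      then obtain ys where ys: "ys \<in> lists N" "length ys = Suc k" "z = sum_eval ys"
        unfolding H_def by blast
      then obtain x xs where "ys = x # xs" by (cases ys) auto
      then have xs: "x \<in> N" "xs \<in> lists N" "length xs = k" "z = sum_eval (x # xs)"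
        using ys by auto
      then have "z = (\<lambda>i. eval_at x i \<noteq> sum_eval xs i)" by (simp add: fun_eq_iff sum_eval_Cons)
      then show "z \<in> (\<lambda>(g, h) i. g i \<noteq> h i) ` (eval_at ` N \<times> H k)"
        using xs by (intro image_eqI[of _ _ "(eval_at x, sum_eval xs)"]) (auto simp: H_def)
    next
      fix z assume "z \<in> (\<lambda>(g, h) i. g i \<noteq> h i) ` (eval_at ` N \<times> H k)"
      then obtain x xs where xs: "x \<in> N" "xs \<in> lists N" "length xs = k"
          "z = (\<lambda>i. eval_at x i \<noteq> sum_eval xs i)"
        unfolding H_def by auto
      then have "z = sum_eval (x # xs)" by (simp add: fun_eq_iff sum_eval_Cons)
      then show "z \<in> H (Suc k)" using xs unfolding H_def by (intro image_eqI[of _ _ "x # xs"]) auto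
    qed
    then show ?case using analytic_in_xor_image[OF E Suc] by simp
  qed
  then have "analytic_in euclidean (\<Union>k. H k)" by (rule analytic_in_UN)
  moreover have "(\<Union>k. H k) = Boolean_span N" by (auto simp: H_def Boolean_span_def)
  ultimately show ?thesis by simp
qed

section \<open>Nowhere dense sets\<close>

text \<open>
  The cylinders are chosen one after the other along a numbering of the words \<open>u\<close>. All earlier
  choices are closed sets that miss \<open>N\<close>, so a sufficiently small neighbourhood of the point
  \<open>x u\<close> of \<open>N\<close> misses them.
\<close>

lemma disjoint_targets:
  fixes N :: "(nat \<Rightarrow> bool) set" and x :: "bool list \<Rightarrow> (nat \<Rightarrow> bool)"
  assumes xN: "\<And>u. x u \<in> N"
    and room: "\<And>z n. z \<in> N \<Longrightarrow> \<exists>w. cyl w \<subseteq> cyl (pre z n) \<and> cyl w \<inter> N = {} \<and> P w"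
  shows "\<exists>v. (\<forall>u. cyl (v u) \<subseteq> cyl (pre (x u) (length u)) \<and> cyl (v u) \<inter> N = {} \<and> P (v u)) \<and>
    (\<forall>u u'. u \<noteq> u' \<longrightarrow> cyl (v u) \<inter> cyl (v u') = {})"
proof -
  define R where "R v i r \<longleftrightarrow> cyl r \<subseteq> cyl (pre (x (from_nat i)) (length (from_nat i :: bool list))) \<and>
      cyl r \<inter> N = {} \<and> P r \<and> (\<forall>j<i. cyl r \<inter> cyl (v j) = {})" for v and i :: nat and r
  have "\<exists>v. \<forall>i. R v i (v i)"
  proof (rule dependent_wellorder_choice)
    show "R v i r = R v' i r" if "\<And>j. j < i \<Longrightarrow> v j = v' j" for r v v' i
      using that unfolding R_def by simp
    fix i v assume IH: "\<And>j. j < i \<Longrightarrow> R v j (v j)"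
    define z where "z = x (from_nat i)"
    have z: "z \<in> N" unfolding z_def by (rule xN)
    define K where "K = Max (insert (length (from_nat i :: bool list)) ((\<lambda>j. length (v j)) ` {..<i}))"
    have K: "length (from_nat i :: bool list) \<le> K" "\<And>j. j < i \<Longrightarrow> length (v j) \<le> K"
      unfolding K_def by (auto intro!: Max_ge)
    obtain w where w: "cyl w \<subseteq> cyl (pre z K)" "cyl w \<inter> N = {}" "P w" using room[OF z] by blast
    have "cyl w \<inter> cyl (v j) = {}" if j: "j < i" for j
    proof -
      have "False" if y: "y \<in> cyl w" "y \<in> cyl (v j)" for y
      proof -
        have "pre y K = pre z K" using y(1) w(1) by auto
        then have "pre y (length (v j)) = pre z (length (v j))" using K(2)[OF j] by (rule pre_eq_mono)
        then have "z \<in> cyl (v j)" using in_cylD[OF y(2)] by (simp add: cyl_def)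
        then show False using IH[OF j] z unfolding R_def by blast
      qed
      then show ?thesis by blast
    qed
    moreover have "cyl (pre z K) \<subseteq> cyl (pre z (length (from_nat i :: bool list)))"
      by (rule cyl_mono[OF prefix_pre[OF K(1)]])
    ultimately have "R v i w" unfolding R_def z_def[symmetric] using w by blast
    then show "\<exists>r. R v i r" by blast
  qed
  then obtain v where v: "\<And>i. R v i (v i)" by blast
  have "cyl (v (to_nat u)) \<inter> cyl (v (to_nat u')) = {}" if "u \<noteq> u'" for u u' :: "bool list"
  proof -
    have "to_nat u < to_nat u' \<or> to_nat u' < to_nat u" using that by (metis linorder_neqE_nat to_nat_split inj_to_nat injD)
    then show ?thesis using v[of "to_nat u"] v[of "to_nat u'"] unfolding R_def by blast
  qed
  moreover have "cyl (v (to_nat u)) \<subseteq> cyl (pre (x u) (length u)) \<and> cyl (v (to_nat u)) \<inter> N = {} \<and> P (v (to_nat u))"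
    for u :: "bool list"
    using v[of "to_nat u"] unfolding R_def from_nat_to_nat by blast
  ultimately show ?thesis by (intro exI[of _ "\<lambda>u. v (to_nat u)"]) blast
qed

text \<open>
  Let \<open>D\<close> be the image of \<open>N\<close> in \<open>H\<close>. A point \<open>h\<close> of \<open>H - D\<close> belongs to the piece given by its shortest
  initial segment \<open>p h\<close> whose cylinder misses \<open>D\<close>. Deleting the last entry of \<open>p h\<close> gives a cylinder
  that meets \<open>D\<close>, so the piece is close to the image of some point \<open>x (p h)\<close> of \<open>N\<close>. If the piece is
  mapped into a cylinder close to \<open>x (p h)\<close>, then the combined map is continuous at the points of \<open>D\<close>, and
  so is its inverse at the points of \<open>N\<close>: there are only finitely many binary words of each length, so
  pieces, and likewise their images, that accumulate at a point have lengths tending to infinity.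
\<close>

lemma extend_embedding:
  fixes H N A :: "(nat \<Rightarrow> bool) set" and \<delta> :: "(nat \<Rightarrow> bool) \<Rightarrow> (nat \<Rightarrow> bool)"
  assumes \<delta>: "emb N \<delta>" "\<delta> ` N \<subseteq> H" and ne: "N \<noteq> {}" and NA: "N \<subseteq> A"
    and closed: "\<And>h. h \<in> H \<Longrightarrow> h \<notin> \<delta> ` N \<Longrightarrow> \<exists>n. cyl (pre h n) \<inter> \<delta> ` N = {}"
    and room: "\<And>z n. z \<in> N \<Longrightarrow> \<exists>w. cyl w \<subseteq> cyl (pre z n) \<and> cyl w \<inter> N = {} \<and>
      (\<exists>e :: (nat \<Rightarrow> bool) \<Rightarrow> (nat \<Rightarrow> bool). emb UNIV e \<and> range e \<subseteq> A \<inter> cyl w)"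
  shows "\<exists>F. emb H F \<and> N \<subseteq> F ` H \<and> F ` H \<subseteq> A"
proof -
  define D where "D = \<delta> ` N"
  define \<delta>' where "\<delta>' = inv_into N \<delta>"
  have \<delta>': "\<delta>' (\<delta> z) = z" if "z \<in> N" for z
    unfolding \<delta>'_def by (rule inv_into_f_f[OF emb_imp_inj_on[OF \<delta>(1)] that])
  define k where "k h = (LEAST k. cyl (pre h k) \<inter> D = {})" for h
  define p where "p h = pre h (k h)" for h
  have k: "cyl (p h) \<inter> D = {}" if "h \<in> H" "h \<notin> D" for h
    unfolding p_def k_def by (rule LeastI_ex) (use closed that in \<open>simp add: D_def\<close>)
  have k_le: "k h \<le> j" if "cyl (pre h j) \<inter> D = {}" for h j
    unfolding k_def using that by (rule Least_le)
  have k_pos: "k h > 0" if "h \<in> H" "h \<notin> D" for h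
  proof (rule ccontr)
    assume "\<not> k h > 0"
    then have "p h = []" by (simp add: p_def)
    then show False using k[OF that] ne by (simp add: D_def)
  qed
  \<comment> \<open>The pieces are clopen in \<open>H\<close>: points that agree up to \<open>k h\<close> are in the same piece.\<close>
  have p_eq: "p h' = p h" if "h \<in> H" "h \<notin> D" and eq: "pre h' (k h) = pre h (k h)" for h h'
  proof -
    have 1: "k h' \<le> k h" using k[OF that(1,2)] eq by (intro k_le) (simp add: p_def)
    have "\<exists>j. cyl (pre h' j) \<inter> D = {}" using k[OF that(1,2)] unfolding p_def eq[symmetric] by blast
    then have "cyl (pre h' (k h')) \<inter> D = {}" unfolding k_def by (rule LeastI_ex)
    then have 2: "k h \<le> k h'" using pre_eq_mono[OF eq 1] by (intro k_le) simp
    show ?thesis using 1 2 eq unfolding p_def by simp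
  qed
  have "\<exists>z. z \<in> N \<and> ((\<exists>y\<in>N. \<delta> y \<in> cyl (butlast u)) \<longrightarrow> \<delta> z \<in> cyl (butlast u))" for u
    using ne by blast
  then obtain x where x: "\<And>u. x u \<in> N" "\<And>u y. y \<in> N \<Longrightarrow> \<delta> y \<in> cyl (butlast u) \<Longrightarrow> \<delta> (x u) \<in> cyl (butlast u)"
    by metis
  have x_near: "pre (\<delta> (x (p h))) (k h - 1) = pre h (k h - 1)" if h: "h \<in> H" "h \<notin> D" for h
  proof -
    have bl: "butlast (p h) = pre h (k h - 1)"
      using k_pos[OF h] by (cases "k h") (simp_all add: p_def pre_Suc)
    have "\<not> cyl (pre h (k h - 1)) \<inter> D = {}" using k_le[of h "k h - 1"] k_pos[OF h] by linarith
    then obtain y where "y \<in> N" "\<delta> y \<in> cyl (butlast (p h))" unfolding bl D_def by blast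
    then have "\<delta> (x (p h)) \<in> cyl (butlast (p h))" by (rule x(2))
    then show ?thesis unfolding bl by simp
  qed
  obtain v where v: "\<And>u. cyl (v u) \<subseteq> cyl (pre (x u) (length u))" "\<And>u. cyl (v u) \<inter> N = {}"
      "\<And>u. \<exists>e :: (nat \<Rightarrow> bool) \<Rightarrow> (nat \<Rightarrow> bool). emb UNIV e \<and> range e \<subseteq> A \<inter> cyl (v u)"
      "\<And>u u'. u \<noteq> u' \<Longrightarrow> cyl (v u) \<inter> cyl (v u') = {}"
    using disjoint_targets[of x N "\<lambda>w. \<exists>e :: (nat \<Rightarrow> bool) \<Rightarrow> (nat \<Rightarrow> bool). emb UNIV e \<and> range e \<subseteq> A \<inter> cyl w",
        OF x(1) room] by metis
  obtain e :: "bool list \<Rightarrow> (nat \<Rightarrow> bool) \<Rightarrow> (nat \<Rightarrow> bool)"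
    where e: "\<And>u. emb UNIV (e u)" "\<And>u. range (e u) \<subseteq> A \<inter> cyl (v u)"
    using v(3) by metis
  \<comment> \<open>On \<open>D\<close> the inverse of \<open>\<delta>\<close>, on each piece an embedding into its own cylinder.\<close>
  define F where "F h = (if h \<in> D then \<delta>' h else e (p h) h)" for h
  have F_D: "F (\<delta> z) = z" if "z \<in> N" for z using that \<delta>' by (simp add: F_def D_def)
  have F_v: "F h \<in> cyl (v (p h))" if "h \<notin> D" for h
  proof -
    have "F h \<in> range (e (p h))" using that by (simp add: F_def)
    then show ?thesis using e(2) by blast
  qed
  have F_near: "pre (F h) (k h) = pre (x (p h)) (k h)" if "h \<notin> D" for h
  proof -
    have "F h \<in> cyl (pre (x (p h)) (length (p h)))" using F_v[OF that] v(1) by blast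
    then show ?thesis by (simp add: p_def)
  qed
  have "emb H F"
    unfolding emb_def
  proof (intro ballI allI)
    fix h n assume h: "h \<in> H"
    show "(\<exists>m. \<forall>y\<in>H. pre y m = pre h m \<longrightarrow> pre (F y) n = pre (F h) n) \<and>
          (\<exists>m. \<forall>y\<in>H. pre (F y) m = pre (F h) m \<longrightarrow> pre y n = pre h n)"
    proof (cases "h \<in> D")
      case False
      define u where "u = p h"
      have Fh: "F h = e u h" using False by (simp add: F_def u_def)
      obtain m where m: "\<And>y. pre y m = pre h m \<Longrightarrow> pre (e u y) n = pre (e u h) n"
        using e(1)[of u] unfolding emb_def by blast
      obtain l where l: "\<And>y. pre (e u y) l = pre (e u h) l \<Longrightarrow> pre y n = pre h n"
        using e(1)[of u] unfolding emb_def by blast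
      have "pre (F y) n = pre (F h) n" if y: "pre y (max m (k h)) = pre h (max m (k h))" for y
      proof -
        have yk: "pre y (k h) = pre h (k h)" by (rule pre_eq_mono[OF y]) simp
        have "p y = u" unfolding u_def by (rule p_eq[OF h False yk])
        moreover have "y \<in> cyl (p h)" using yk by (simp add: p_def)
        then have "y \<notin> D" using k[OF h False] by blast
        ultimately have "F y = e u y" by (simp add: F_def)
        moreover have "pre (e u y) n = pre (e u h) n" by (rule m) (rule pre_eq_mono[OF y], simp)
        ultimately show ?thesis using Fh by simp
      qed
      moreover have "pre y n = pre h n"
        if yH: "y \<in> H" and y: "pre (F y) (max l (length (v u))) = pre (F h) (max l (length (v u)))" for y
      proof -
        have "pre (F y) (length (v u)) = pre (F h) (length (v u))" by (rule pre_eq_mono[OF y]) simp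
        then have Fy: "F y \<in> cyl (v u)" using in_cylD[OF F_v[OF False]] by (simp add: cyl_def u_def)
        have yD: "y \<notin> D"
        proof
          assume "y \<in> D"
          then obtain z where "z \<in> N" "y = \<delta> z" unfolding D_def by blast
          then have "F y \<in> N" using F_D by simp
          then show False using Fy v(2) by blast
        qed
        have "p y = u" using F_v[OF yD] Fy v(4) by blast
        then have "F y = e u y" using yD by (simp add: F_def)
        moreover have "pre (F y) l = pre (F h) l" by (rule pre_eq_mono[OF y]) simp
        ultimately show ?thesis using Fh by (intro l) simp
      qed
      ultimately show ?thesis by blast
    next
      case True
      then obtain z where z: "z \<in> N" "h = \<delta> z" unfolding D_def by blast
      have Fh: "F h = z" using F_D z by simp
      obtain m0 where m0: "\<And>z'. z' \<in> N \<Longrightarrow> pre (\<delta> z') m0 = pre (\<delta> z) m0 \<Longrightarrow> pre z' n = pre z n"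
        using \<delta>(1) z(1) unfolding emb_def by blast
      obtain n0 where n0: "\<And>z'. z' \<in> N \<Longrightarrow> pre z' n0 = pre z n0 \<Longrightarrow> pre (\<delta> z') n = pre (\<delta> z) n"
        using \<delta>(1) z(1) unfolding emb_def by blast
      have "pre (F y) n = pre (F h) n" if yH: "y \<in> H" and y: "pre y (max m0 n) = pre h (max m0 n)" for y
      proof (cases "y \<in> D")
        case True
        then obtain z' where z': "z' \<in> N" "y = \<delta> z'" unfolding D_def by blast
        have "pre (\<delta> z') m0 = pre (\<delta> z) m0"
          unfolding z'(2)[symmetric] z(2)[symmetric] by (rule pre_eq_mono[OF y]) simp
        then show ?thesis using m0[OF z'(1)] F_D z' Fh by simp
      next
        case False
        have "max m0 n < k y"
        proof (rule ccontr)
          assume "\<not> max m0 n < k y"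
          then have "k y \<le> max m0 n" by (rule leI)
          then have "pre y (k y) = pre h (k y)" by (rule pre_eq_mono[OF y])
          then have "h \<in> cyl (p y)" by (simp add: p_def)
          then show False using k[OF yH False] \<open>h \<in> D\<close> by blast
        qed
        then have le: "m0 \<le> k y - 1" "n \<le> k y" by auto
        have "pre (\<delta> (x (p y))) m0 = pre y m0" by (rule pre_eq_mono[OF x_near[OF yH False] le(1)])
        also have "\<dots> = pre h m0" by (rule pre_eq_mono[OF y]) simp
        finally have "pre (x (p y)) n = pre z n" unfolding z(2) by (rule m0[OF x(1)])
        moreover have "pre (F y) n = pre (x (p y)) n" by (rule pre_eq_mono[OF F_near[OF False] le(2)])
        ultimately show ?thesis using Fh by simp
      qed
      moreover
      define K where "K = max n0 n"
      \<comment> \<open>Beyond \<open>M\<close>, closeness to \<open>z\<close> excludes the finitely many target cylinders of short words.\<close>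
      define M where "M = Max (insert n0 ((\<lambda>u. length (v u)) ` {u. set u \<subseteq> UNIV \<and> length u \<le> K}))"
      have fin: "finite {u :: bool list. set u \<subseteq> UNIV \<and> length u \<le> K}"
        by (rule finite_lists_length_le) simp
      have M: "n0 \<le> M" "\<And>u. length u \<le> K \<Longrightarrow> length (v u) \<le> M"
        unfolding M_def using fin by (auto intro!: Max_ge)
      have "pre y n = pre h n" if yH: "y \<in> H" and y: "pre (F y) M = pre (F h) M" for y
      proof (cases "y \<in> D")
        case True
        then obtain z' where z': "z' \<in> N" "y = \<delta> z'" unfolding D_def by blast
        have "pre z' n0 = pre z n0"
          using pre_eq_mono[OF y M(1)] F_D z' Fh by simp
        then show ?thesis using n0[OF z'(1)] z z' by simp
      next
        case False
        have kK: "K < k y"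
        proof (rule ccontr)
          assume "\<not> K < k y"
          then have "length (p y) \<le> K" by (simp add: p_def)
          then have "pre (F y) (length (v (p y))) = pre z (length (v (p y)))"
            using pre_eq_mono[OF y M(2)] Fh by simp
          then have "z \<in> cyl (v (p y))" using in_cylD[OF F_v[OF False]] by (simp add: cyl_def)
          then show False using v(2) z(1) by blast
        qed
        then have le: "n0 \<le> k y" "n \<le> k y - 1" by (auto simp: K_def)
        have "pre (x (p y)) n0 = pre (F y) n0" by (rule pre_eq_mono[OF F_near[OF False, symmetric] le(1)])
        also have "\<dots> = pre z n0" using pre_eq_mono[OF y M(1)] Fh by simp
        finally have "pre (\<delta> (x (p y))) n = pre h n" unfolding z(2) by (rule n0[OF x(1)])
        moreover have "pre (\<delta> (x (p y))) n = pre y n" by (rule pre_eq_mono[OF x_near[OF yH False] le(2)])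
        ultimately show ?thesis by simp
      qed
      ultimately show ?thesis by blast
    qed
  qed
  moreover have "N \<subseteq> F ` H"
  proof
    fix z assume "z \<in> N"
    then show "z \<in> F ` H" using F_D[of z] \<delta>(2) by (metis image_eqI image_subset_iff)
  qed
  moreover have "F ` H \<subseteq> A"
  proof
    fix y assume "y \<in> F ` H"
    then obtain h where "y = F h" by blast
    then show "y \<in> A" using F_D NA e(2)[of "p h"] by (cases "h \<in> D") (auto simp: D_def F_def \<delta>')
  qed
  ultimately show ?thesis by blast
qed

lemma emb_bool_nat: "emb UNIV (\<lambda>(y :: nat \<Rightarrow> bool) i. of_bool (y i) :: nat)"
  unfolding emb_def pre_eq_iff by (intro ballI allI conjI; rule exI; auto)

text \<open>
  The homogeneous space is the Boolean group spanned by \<open>A \<inter> C\<close>. Since \<open>C\<close> is nowhere dense in \<open>A\<close>,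
  there are points of \<open>A - C\<close> close to every point of \<open>A \<inter> C\<close>, and since \<open>A\<close> is uncountable
  around them, Cantor sets inside \<open>A\<close> that receive the pieces of the group.
\<close>

lemma nowhere_dense_subset_of_homogeneous:
  fixes A C :: "(nat \<Rightarrow> bool) set"
  assumes A: "analytic_in euclidean A"
    and unc: "\<And>x n. x \<in> A \<Longrightarrow> uncountable (A \<inter> cyl (pre x n))"
    and C: "closed C" and nd: "\<And>x n. x \<in> A \<inter> C \<Longrightarrow> \<exists>z\<in>A \<inter> cyl (pre x n). z \<notin> C"
    and ne: "A \<inter> C \<noteq> {}"
  shows "\<exists>Y. A \<inter> C \<subseteq> Y \<and> Y \<subseteq> A \<and> analytic_in euclidean Y \<and> homogeneous_space (top_of_set Y)"
proof -
  define N where "N = A \<inter> C"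
  have N: "analytic_in euclidean N"
    unfolding N_def by (rule analytic_in_Int_closed[OF A]) (use C in simp)
  have room: "\<exists>w. cyl w \<subseteq> cyl (pre x n) \<and> cyl w \<inter> N = {} \<and>
      (\<exists>e :: (nat \<Rightarrow> bool) \<Rightarrow> (nat \<Rightarrow> bool). emb UNIV e \<and> range e \<subseteq> A \<inter> cyl w)" if x: "x \<in> N" for x n
  proof -
    obtain z where z: "z \<in> A" "z \<in> cyl (pre x n)" "z \<notin> C" using nd x unfolding N_def by blast
    have "open (- C)" using C by (simp add: open_Compl)
    then obtain m where m: "cyl (pre z m) \<subseteq> - C" using open_contains_cyl z(3) by blast
    define w where "w = pre z (max m n)"
    have "cyl w \<subseteq> cyl (pre z m)" unfolding w_def by (rule cyl_mono[OF prefix_pre]) simp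
    then have "cyl w \<inter> N = {}" using m unfolding N_def by blast
    moreover have "pre z n = pre x n" using z(2) by simp
    then have "cyl w \<subseteq> cyl (pre x n)" unfolding w_def by (metis cyl_mono prefix_pre max.cobounded2)
    moreover obtain g :: "(nat \<Rightarrow> nat) \<Rightarrow> (nat \<Rightarrow> bool)" where g: "emb UNIV g" "range g \<subseteq> A \<inter> cyl w"
      using perfect_set[OF A unc[OF z(1)]] unfolding w_def by blast
    have "emb UNIV (g \<circ> (\<lambda>(y :: nat \<Rightarrow> bool) i. of_bool (y i) :: nat))"
      by (rule emb_compose[OF emb_bool_nat g(1)]) simp
    moreover have "range (g \<circ> (\<lambda>(y :: nat \<Rightarrow> bool) i. of_bool (y i) :: nat)) \<subseteq> A \<inter> cyl w"
      using g(2) by auto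
    ultimately show ?thesis by blast
  qed
  have "\<exists>F. emb (Boolean_span N) F \<and> N \<subseteq> F ` Boolean_span N \<and> F ` Boolean_span N \<subseteq> A"
  proof (rule extend_embedding[where \<delta> = eval_at])
    show "emb N eval_at" by (rule emb_eval_at)
    show "eval_at ` N \<subseteq> Boolean_span N" using eval_at_in_Boolean_span by blast
    show "N \<noteq> {}" "N \<subseteq> A" using ne by (auto simp: N_def)
  qed (fact eval_at_closed_in_Boolean_span room)+
  then obtain F where F: "emb (Boolean_span N) F" "N \<subseteq> F ` Boolean_span N" "F ` Boolean_span N \<subseteq> A"
    by blast
  have "analytic_in euclidean (F ` Boolean_span N)"
    by (rule analytic_in_image[OF analytic_Boolean_span[OF N]])
      (use emb_imp_continuous_on[OF F(1)] in simp)
  moreover have "homogeneous_space (top_of_set (F ` Boolean_span N))"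
    by (rule homogeneous_space_homeomorphic[OF homogeneous_Boolean_span emb_homeomorphic_space[OF F(1)]])
  ultimately show ?thesis using F(2,3) unfolding N_def by blast
qed

section \<open>Covering analytic sets by homogeneous pieces\<close>

text \<open>
  Suppose that \<open>J\<close> contains the relatively closed nowhere dense subsets of \<open>A\<close>, but no nonempty
  relatively open subset of \<open>A\<close>. Then the copy of the Baire space arises from a scheme with the invariant
  that the image \<open>f ` cyl v\<close> is not in \<open>J\<close> on any relatively open part of \<open>A \<inter> cyl u\<close>. If this
  holds for \<open>v\<close>, then every relatively open part of \<open>A \<inter> cyl u\<close> has a subcylinder on which it holds for a
  one-step extension of \<open>v\<close>. The maximal cylinders of that kind are disjoint and have a dense
  union, so they miss a nowhere dense set only.
\<close>

lemma conull_copy_of_Baire_space: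
  fixes A :: "(nat \<Rightarrow> bool) set" and f :: "(nat \<Rightarrow> nat) \<Rightarrow> (nat \<Rightarrow> bool)"
  assumes J: "sigma_ideal J" and f: "continuous_on UNIV f" "range f = A"
    and unc: "\<And>B. countable B \<Longrightarrow> B \<subseteq> A \<Longrightarrow> B \<in> J"
    and nd: "\<And>C. closed C \<Longrightarrow> (\<And>x n. x \<in> A \<inter> C \<Longrightarrow> \<exists>z\<in>A \<inter> cyl (pre x n). z \<notin> C) \<Longrightarrow> A \<inter> C \<in> J"
    and pos: "\<And>x n. x \<in> A \<Longrightarrow> A \<inter> cyl (pre x n) \<notin> J"
  shows "\<exists>g :: (nat \<Rightarrow> nat) \<Rightarrow> (nat \<Rightarrow> bool). emb UNIV g \<and> range g \<subseteq> A \<and> A - range g \<in> J"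
proof -
  interpret sigma_ideal J by fact
  have pos': "A \<inter> cyl u \<notin> J" if ne: "A \<inter> cyl u \<noteq> {}" for u
  proof -
    obtain x where "x \<in> A" "x \<in> cyl u" using ne by blast
    then show ?thesis using pos[of x "length u"] by (simp add: in_cylD)
  qed
  define Q where "Q u v \<longleftrightarrow> A \<inter> cyl u \<noteq> {} \<and>
      (\<forall>u'. prefix u u' \<longrightarrow> A \<inter> cyl u' \<noteq> {} \<longrightarrow> f ` cyl v \<inter> cyl u' \<notin> J)" for u v
  have Q_mono: "Q u' v" if "Q u v" "prefix u u'" "A \<inter> cyl u' \<noteq> {}" for u u' v
    using that unfolding Q_def by (meson prefix_order.trans)
  have dense1: "\<exists>u' a. prefix w u' \<and> Q u' (v @ [a])"
    if Q: "Q u v" and w: "prefix u w" "A \<inter> cyl w \<noteq> {}" for u v w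
  proof (rule ccontr)
    assume no: "\<nexists>u' a. prefix w u' \<and> Q u' (v @ [a])"
    have "f ` cyl v \<inter> cyl w \<notin> J" using Q w unfolding Q_def by blast
    moreover have "f ` cyl v \<inter> cyl w = (\<Union>a. f ` cyl (v @ [a]) \<inter> cyl w)"
      unfolding image_cyl_split[of f v] by blast
    ultimately obtain a where a: "f ` cyl (v @ [a]) \<inter> cyl w \<notin> J"
      using countable_UN[of UNIV "\<lambda>a. f ` cyl (v @ [a]) \<inter> cyl w"] by auto
    \<comment> \<open>If no extension were suitable, the cylinders where \<open>f ` cyl (v @ [a])\<close> is in \<open>J\<close> would be dense.\<close>
    define bad where "bad = {u'. prefix w u' \<and> f ` cyl (v @ [a]) \<inter> cyl u' \<in> J}"
    define C where "C = cyl w - (\<Union>u'\<in>bad. cyl u')"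
    have "closed C" unfolding C_def by (intro closed_Diff closed_cyl open_UN ballI open_cyl)
    then have "A \<inter> C \<in> J"
    proof (rule nd)
      fix x n assume x: "x \<in> A \<inter> C"
      define u' where "u' = pre x (max n (length w))"
      have xw: "x \<in> cyl w" using x by (simp add: C_def)
      have "prefix w u'" unfolding u'_def prefix_pre_iff using xw by simp
      moreover have "A \<inter> cyl u' \<noteq> {}" using x unfolding u'_def by auto
      moreover have "\<not> Q u' (v @ [a])" using no \<open>prefix w u'\<close> by blast
      ultimately obtain u'' where u'': "prefix u' u''" "A \<inter> cyl u'' \<noteq> {}" "f ` cyl (v @ [a]) \<inter> cyl u'' \<in> J"
        unfolding Q_def by blast
      then have "u'' \<in> bad" using \<open>prefix w u'\<close> prefix_order.trans unfolding bad_def by blast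
      obtain z where z: "z \<in> A" "z \<in> cyl u''" using u''(2) by blast
      have "z \<in> cyl u'" using z(2) cyl_mono[OF u''(1)] by blast
      then have "z \<in> cyl (pre x n)"
        unfolding u'_def in_cyl_pre using pre_eq_mono[of z "max n (length w)" x n] by simp
      moreover have "z \<notin> C" using z(2) \<open>u'' \<in> bad\<close> unfolding C_def by blast
      ultimately show "\<exists>z\<in>A \<inter> cyl (pre x n). z \<notin> C" using z(1) by blast
    qed
    moreover have "(\<Union>u'\<in>bad. f ` cyl (v @ [a]) \<inter> cyl u') \<in> J"
      by (rule countable_UN) (auto simp: bad_def)
    ultimately have "(A \<inter> C) \<union> (\<Union>u'\<in>bad. f ` cyl (v @ [a]) \<inter> cyl u') \<in> J" by (rule Un)
    moreover have "f ` cyl (v @ [a]) \<inter> cyl w \<subseteq> (A \<inter> C) \<union> (\<Union>u'\<in>bad. f ` cyl (v @ [a]) \<inter> cyl u')"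
      using f(2) unfolding C_def by blast
    ultimately show False using a subset by blast
  qed
  have "\<exists>g :: (nat \<Rightarrow> nat) \<Rightarrow> (nat \<Rightarrow> bool). emb UNIV g \<and> range g \<subseteq> range f \<inter> cyl [] \<and>
    A \<inter> cyl [] - range g \<in> J"
  proof (rule scheme_from_steps[where Q=Q and vr="[]", OF J f(1)])
    show "Q [] []" unfolding Q_def using f(2) pos' by auto
    show "f ` cyl v \<inter> cyl u \<noteq> {}" if "Q u v" for u v
      using that unc[of "{}"] unfolding Q_def by force
    fix u v assume Q: "Q u v"
    obtain p where p: "p \<in> A" "p \<in> cyl u" using Q unfolding Q_def by blast
    \<comment> \<open>Omitting the point \<open>p\<close> makes the family of cylinders infinite: a finite union would be closed.\<close>
    define CC where "CC = {u'. strict_prefix u u' \<and> p \<notin> cyl u' \<and> (\<exists>a. Q u' (v @ [a]))}"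
    have dense: "\<exists>u'\<in>CC. prefix w u'" if w: "prefix u w" "A \<inter> cyl w \<noteq> {}" for w
    proof -
      obtain u1 a where u1: "prefix w u1" "Q u1 (v @ [a])" using dense1[OF Q w] by blast
      have "A \<inter> cyl u1 \<notin> J" using u1(2) pos' unfolding Q_def by blast
      then have "\<not> countable (A \<inter> cyl u1)" using unc[of "A \<inter> cyl u1"] by blast
      then have "\<not> A \<inter> cyl u1 \<subseteq> {p}" using countable_subset[of _ "{p}"] by (metis countable_empty countable_insert)
      then obtain z where z: "z \<in> A" "z \<in> cyl u1" "z \<noteq> p" by blast
      then obtain k where k: "pre z k \<noteq> pre p k" using eq_if_pre_eq by blast
      define u' where "u' = pre z (max k (Suc (length u1)))"
      have "prefix u1 u'" unfolding u'_def prefix_pre_iff using z(2) by simp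
      then have "prefix w u'" "prefix u u'" using u1(1) w(1) prefix_order.trans by blast+
      moreover have "length u < length u'"
        using prefix_length_le[OF prefix_order.trans[OF w(1) u1(1)]] by (simp add: u'_def)
      ultimately have "strict_prefix u u'" unfolding strict_prefix_def by blast
      moreover have "p \<notin> cyl u'"
        using k pre_eq_mono[of p "max k (Suc (length u1))" z k] unfolding u'_def in_cyl_pre by auto
      moreover have "A \<inter> cyl u' \<noteq> {}" using z(1) unfolding u'_def by auto
      then have "Q u' (v @ [a])" by (rule Q_mono[OF u1(2) \<open>prefix u1 u'\<close>])
      ultimately show ?thesis using \<open>prefix w u'\<close> unfolding CC_def by blast
    qed
    \<comment> \<open>Shortest words, that is, maximal cylinders.\<close>
    define M where "M = {u'\<in>CC. \<forall>w\<in>CC. prefix w u' \<longrightarrow> w = u'}"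
    have below: "\<exists>w\<in>M. prefix w u'" if u': "u' \<in> CC" for u'
    proof -
      obtain w where w: "w \<in> CC \<and> prefix w u'" "\<And>r. r \<in> CC \<and> prefix r u' \<Longrightarrow> length w \<le> length r"
        using ex_has_least_nat[of "\<lambda>w. w \<in> CC \<and> prefix w u'" u' length] u' by blast
      have "r = w" if "r \<in> CC" "prefix r w" for r
      proof -
        have "prefix r u'" using that(2) w(1) prefix_order.trans by blast
        then have "length w \<le> length r" using w(2) that(1) by blast
        then show ?thesis using that(2) by (metis prefix_length_prefix prefix_order.antisym prefix_order.refl)
      qed
      then show ?thesis using w(1) unfolding M_def by blast
    qed
    have M_disj: "cyl r \<inter> cyl w = {}" if rw: "r \<in> M" "w \<in> M" "r \<noteq> w" for r w
    proof (rule ccontr)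
      assume "cyl r \<inter> cyl w \<noteq> {}"
      then obtain y where "y \<in> cyl r" "y \<in> cyl w" by blast
      then have "prefix r w \<or> prefix w r" using in_two_cyls nat_le_linear by blast
      then show False using rw unfolding M_def by blast
    qed
    have "infinite M"
    proof
      assume "finite M"
      define K where "K = Max (insert (length u) (length ` M))"
      have K: "length u \<le> K" "\<And>w. w \<in> M \<Longrightarrow> length w \<le> K"
        unfolding K_def using \<open>finite M\<close> by (auto intro!: Max_ge)
      have "prefix u (pre p K)" using p(2) K(1) by (simp add: prefix_pre_iff)
      moreover have "A \<inter> cyl (pre p K) \<noteq> {}" using p(1) by auto
      ultimately obtain u' where u': "u' \<in> CC" "prefix (pre p K) u'" using dense by blast
      obtain w where w: "w \<in> M" "prefix w u'" using below[OF u'(1)] by blast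
      have "prefix w (pre p K)" using prefix_length_prefix[OF w(2) u'(2)] K(2)[OF w(1)] by simp
      then have "p \<in> cyl w" by (simp add: prefix_pre_iff)
      then show False using w(1) unfolding M_def CC_def by blast
    qed
    define b where "b = from_nat_into M"
    have b: "bij_betw b UNIV M"
      unfolding b_def by (rule bij_betw_from_nat_into) (use \<open>infinite M\<close> in auto)
    have bM: "b n \<in> M" for n using b by (auto simp: bij_betw_def)
    have "\<exists>a. Q (b n) (v @ [a])" and bu: "strict_prefix u (b n)" for n
      using bM[of n] unfolding M_def CC_def by blast+
    then obtain a where a: "\<And>n. Q (b n) (v @ [a n])" by metis
    have disj: "cyl (b m) \<inter> cyl (b n) = {}" if mn: "m \<noteq> n" for m n
    proof (rule M_disj[OF bM bM])
      show "b m \<noteq> b n" using b mn unfolding bij_betw_def by (metis injD)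
    qed
    define C where "C = cyl u - (\<Union>w\<in>M. cyl w)"
    have "closed C" unfolding C_def by (intro closed_Diff closed_cyl open_UN ballI open_cyl)
    then have "A \<inter> C \<in> J"
    proof (rule nd)
      fix x n assume x: "x \<in> A \<inter> C"
      define r where "r = pre x (max n (length u))"
      have "x \<in> cyl u" using x by (simp add: C_def)
      then have "prefix u r" unfolding r_def prefix_pre_iff by simp
      moreover have "A \<inter> cyl r \<noteq> {}" using x unfolding r_def by auto
      ultimately obtain u' where u': "u' \<in> CC" "prefix r u'" using dense by blast
      then have "A \<inter> cyl u' \<noteq> {}" unfolding CC_def Q_def by blast
      then obtain z where z: "z \<in> A" "z \<in> cyl u'" by blast
      obtain w where w: "w \<in> M" "prefix w u'" using below[OF u'(1)] by blast
      have "z \<notin> C" using z(2) cyl_mono[OF w(2)] w(1) unfolding C_def by blast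
      moreover have "z \<in> cyl r" using z(2) cyl_mono[OF u'(2)] by blast
      then have "z \<in> cyl (pre x n)"
        unfolding r_def in_cyl_pre using pre_eq_mono[of z "max n (length u)" x n] by simp
      ultimately show "\<exists>z\<in>A \<inter> cyl (pre x n). z \<notin> C" using z(1) by blast
    qed
    moreover have "(\<Union>n. cyl (b n)) = (\<Union>w\<in>M. cyl w)" using b by (auto simp: bij_betw_def)
    then have "A \<inter> C = A \<inter> cyl u - (\<Union>n. cyl (b n))" unfolding C_def by blast
    ultimately have rest: "A \<inter> cyl u - (\<Union>n. cyl (b n)) \<in> J" by simp
    show "\<exists>u' v'. (\<forall>n::nat. Q (u' n) (v' n) \<and> strict_prefix u (u' n) \<and>
        (\<exists>a. v' n = v @ [a])) \<and> (\<forall>m n. m \<noteq> n \<longrightarrow> cyl (u' m) \<inter> cyl (u' n) = {}) \<and>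
        A \<inter> cyl u - (\<Union>n. cyl (u' n)) \<in> J"
      by (intro exI[of _ b] exI[of _ "\<lambda>n. v @ [a n]"]) (use a bu disj rest in simp)
  qed
  then show ?thesis using f(2) by simp
qed

definition countably_covered :: "'a set set \<Rightarrow> 'a set set" where
  "countably_covered \<P> = {B. \<exists>\<S>. countable \<S> \<and> \<S> \<subseteq> \<P> \<and> B \<subseteq> \<Union>\<S>}"

lemma sigma_ideal_countably_covered: "sigma_ideal (countably_covered \<P>)"
proof
  show "B \<in> countably_covered \<P>" if "A \<in> countably_covered \<P>" "B \<subseteq> A" for A B
    using that unfolding countably_covered_def mem_Collect_eq by (meson order_trans)
  show "\<Union>\<A> \<in> countably_covered \<P>" if \<A>: "countable \<A>" "\<A> \<subseteq> countably_covered \<P>" for \<A>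
  proof -
    have "\<forall>A\<in>\<A>. \<exists>\<S>. countable \<S> \<and> \<S> \<subseteq> \<P> \<and> A \<subseteq> \<Union>\<S>"
      using \<A>(2) unfolding countably_covered_def by (simp add: subset_iff)
    then obtain \<S> where \<S>: "\<forall>A\<in>\<A>. countable (\<S> A) \<and> \<S> A \<subseteq> \<P> \<and> A \<subseteq> \<Union>(\<S> A)"
      by (rule bchoice[THEN exE])
    show ?thesis unfolding countably_covered_def
    proof (intro CollectI exI conjI)
      show "countable (\<Union>A\<in>\<A>. \<S> A)" using \<A>(1) by (rule countable_UN) (use \<S> in blast)
      show "(\<Union>A\<in>\<A>. \<S> A) \<subseteq> \<P>" using \<S> by blast
      show "\<Union>\<A> \<subseteq> \<Union>(\<Union>A\<in>\<A>. \<S> A)"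
      proof
        fix y assume "y \<in> \<Union>\<A>"
        then obtain A where "A \<in> \<A>" "y \<in> A" by blast
        moreover then have "y \<in> \<Union>(\<S> A)" using \<S> by blast
        ultimately show "y \<in> \<Union>(\<Union>A\<in>\<A>. \<S> A)" by blast
      qed
    qed
  qed
qed

lemma countably_coveredI:
  assumes "S \<in> \<P>" "B \<subseteq> S"
  shows "B \<in> countably_covered \<P>"
  unfolding countably_covered_def using assms by (intro CollectI exI[of _ "{S}"]) simp

definition homogeneous_pieces :: "(nat \<Rightarrow> bool) set \<Rightarrow> (nat \<Rightarrow> bool) set set" where
  "homogeneous_pieces X =
     {S. S \<subseteq> X \<and> analytic_in euclidean S \<and> homogeneous_space (top_of_set S)}"

lemma countable_is_covered:
  assumes "countable B" "B \<subseteq> X"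
  shows "B \<in> countably_covered (homogeneous_pieces X)"
  unfolding countably_covered_def
proof (intro CollectI exI conjI)
  show "countable ((\<lambda>b. {b}) ` B)" using assms(1) by simp
  show "(\<lambda>b. {b}) ` B \<subseteq> homogeneous_pieces X"
    using assms(2) by (auto simp: homogeneous_pieces_def analytic_in_singleton homogeneous_singleton)
qed simp

text \<open>
  Restricting \<open>X\<close> to the set \<open>A\<close> of points that have no covered neighbourhood in \<open>X\<close> loses only a covered
  set, because there are countably many cylinders.
\<close>

lemma analytic_is_covered:
  assumes X: "analytic_in euclidean X"
  shows "X \<in> countably_covered (homogeneous_pieces X)"
proof -
  define J where "J = countably_covered (homogeneous_pieces X)"
  interpret sigma_ideal J unfolding J_def by (rule sigma_ideal_countably_covered)
  define \<U> where "\<U> = {u. X \<inter> cyl u \<in> J}"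
  define A where "A = X \<inter> - (\<Union>u\<in>\<U>. cyl u)"
  have "closedin euclidean (- (\<Union>u\<in>\<U>. cyl u))"
    unfolding closed_closedin[symmetric] by (intro closed_Compl open_UN ballI open_cyl)
  then have "analytic_in euclidean A"
    unfolding A_def by (rule analytic_in_Int_closed[OF X])
  have rest: "X - A \<in> J"
  proof -
    have "(\<Union>u\<in>\<U>. X \<inter> cyl u) \<in> J" by (rule countable_UN) (auto simp: \<U>_def)
    then show ?thesis by (rule subset) (auto simp: A_def)
  qed
  have pos: "A \<inter> cyl (pre x n) \<notin> J" if x: "x \<in> A" for x n
  proof
    assume "A \<inter> cyl (pre x n) \<in> J"
    then have "(A \<inter> cyl (pre x n)) \<union> (X - A) \<in> J" using rest by (rule Un)
    then have "X \<inter> cyl (pre x n) \<in> J" by (rule subset) blast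
    then have "pre x n \<in> \<U>" by (simp add: \<U>_def)
    moreover have "x \<in> cyl (pre x n)" by simp
    ultimately show False using x unfolding A_def by blast
  qed
  have AX: "A \<subseteq> X" by (simp add: A_def)
  have ctbl: "B \<in> J" if "countable B" "B \<subseteq> A" for B
    unfolding J_def by (rule countable_is_covered) (use that AX in auto)
  have nd: "A \<inter> C \<in> J"
    if C: "closed C" and nd: "\<And>x n. x \<in> A \<inter> C \<Longrightarrow> \<exists>z\<in>A \<inter> cyl (pre x n). z \<notin> C" for C
  proof (cases "A \<inter> C = {}")
    case True
    then show ?thesis using ctbl[of "{}"] by simp
  next
    case False
    have unc: "uncountable (A \<inter> cyl (pre x n))" if "x \<in> A" for x n
      using pos[OF that] ctbl by blast
    obtain Y where "A \<inter> C \<subseteq> Y" "Y \<subseteq> A" "analytic_in euclidean Y" "homogeneous_space (top_of_set Y)"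
      using nowhere_dense_subset_of_homogeneous[OF \<open>analytic_in euclidean A\<close> unc C nd False] by blast
    then show ?thesis unfolding J_def using AX
      by (intro countably_coveredI[of Y]) (auto simp: homogeneous_pieces_def)
  qed
  have "A \<in> J"
  proof (cases "A = {}")
    case True
    then show ?thesis using ctbl[of "{}"] by simp
  next
    case False
    then obtain f :: "(nat \<Rightarrow> nat) \<Rightarrow> (nat \<Rightarrow> bool)" where f: "continuous_on UNIV f" "range f = A"
      using \<open>analytic_in euclidean A\<close> analytic_in_iff_Baire_image[of A] by auto
    obtain g :: "(nat \<Rightarrow> nat) \<Rightarrow> (nat \<Rightarrow> bool)" where
      g: "emb UNIV g" "range g \<subseteq> A" "A - range g \<in> J"
      using conull_copy_of_Baire_space[OF sigma_ideal_axioms f ctbl nd pos] by blast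
    have "homogeneous_space (top_of_set (range g))"
      using homogeneous_space_homeomorphic[OF homogeneous_Baire] emb_homeomorphic_space[OF g(1)] by simp
    moreover have "analytic_in euclidean (range g)"
      by (rule analytic_inI[OF Polish_space_Baire, of _ g])
        (use emb_imp_continuous_on[OF g(1)] in auto)
    ultimately have "range g \<in> J"
      unfolding J_def using g(2) AX
      by (intro countably_coveredI[of "range g"]) (auto simp: homogeneous_pieces_def)
    then have "range g \<union> (A - range g) \<in> J" using g(3) by (rule Un)
    then show ?thesis by (rule subset) blast
  qed
  then have "A \<union> (X - A) \<in> J" using rest by (rule Un)
  then have "X \<in> J" by (rule subset) blast
  then show ?thesis by (simp add: J_def)
qed

lemma sigma_homogeneous_Cantor:
  fixes X :: "(nat \<Rightarrow> bool) set"
  assumes "analytic_in euclidean X"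
  shows "\<exists>S :: nat \<Rightarrow> (nat \<Rightarrow> bool) set. (\<forall>n. S n \<subseteq> X \<and> homogeneous_space (top_of_set (S n)) \<and>
        analytic_in euclidean (S n)) \<and> X = (\<Union>n. S n)"
proof -
  obtain \<S> where \<S>: "countable \<S>" "\<S> \<subseteq> homogeneous_pieces X" "X \<subseteq> \<Union>\<S>"
    using analytic_is_covered[OF assms] unfolding countably_covered_def by blast
  define S where "S = from_nat_into (insert {} \<S>)"
  have r: "range S = insert {} \<S>"
    unfolding S_def by (rule range_from_nat_into) (use \<S>(1) in auto)
  have "S n \<subseteq> X \<and> homogeneous_space (top_of_set (S n)) \<and> analytic_in euclidean (S n)" for n
  proof -
    have "S n \<in> insert {} \<S>" using r by blast
    then show ?thesis using \<S>(2) homogeneous_space_empty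
      by (auto simp: analytic_in_empty homogeneous_pieces_def)
  qed
  moreover have "X = (\<Union>n. S n)"
  proof
    show "X \<subseteq> (\<Union>n. S n)" using \<S>(3) r by simp
  qed (use calculation in blast)
  ultimately show ?thesis by blast
qed

theorem theorem3p4:
  fixes X :: "'a topology"
  assumes "separable_space X" and "metrizable_space X"
    and "zero_dimensional_space X"
    and "analytic_space X"
  shows "\<exists>S :: nat \<Rightarrow> 'a set.
           (\<forall>n. S n \<subseteq> topspace X \<and> homogeneous_space (subtopology X (S n)) \<and> S n \<in> Sigma11 X)
           \<and> topspace X = (\<Union>n. S n)"
proof -
  obtain e where e: "embedding_map X (euclidean :: (nat \<Rightarrow> bool) topology) e"
    using zero_dimensional_embeds_in_Cantor assms(1-3) by blast
  define A where "A = e ` topspace X"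
  obtain k where k: "homeomorphic_maps X (top_of_set A) e k"
    using e unfolding embedding_map_def homeomorphic_map_maps A_def by blast
  have ek: "continuous_map X (top_of_set A) e" "continuous_map (top_of_set A) X k"
    and ke: "\<And>x. x \<in> topspace X \<Longrightarrow> k (e x) = x"
    using k by (auto simp: homeomorphic_maps_def)
  obtain Z :: "(nat \<Rightarrow> nat) topology" and j where
    Z: "Polish_space Z" "embedding_map X Z j" "analytic_in Z (j ` topspace X)"
    using assms(4) unfolding analytic_space_def by blast
  have "continuous_map X (subtopology Z (j ` topspace X)) j"
    using Z(2) unfolding embedding_map_def by (rule homeomorphic_imp_continuous_map)
  then have jcont: "continuous_map X Z j" by (simp add: continuous_map_in_subtopology)
  have "analytic_in euclidean A"
    unfolding A_def
    by (rule analytic_in_image[OF analytic_in_itself_if_embedded[OF Z]])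
      (use ek(1) in \<open>auto simp: continuous_map_in_subtopology\<close>)
  then obtain S :: "nat \<Rightarrow> (nat \<Rightarrow> bool) set" where
    S: "\<And>n. S n \<subseteq> A" "\<And>n. homogeneous_space (top_of_set (S n))"
      "\<And>n. analytic_in euclidean (S n)" "A = (\<Union>n. S n)"
    using sigma_homogeneous_Cantor by metis
  have kA: "k ` A = topspace X" unfolding A_def using ke by force
  show ?thesis
  proof (intro exI[of _ "\<lambda>n. k ` S n"] conjI allI)
    fix n
    show sub: "k ` S n \<subseteq> topspace X" using S(1)[of n] kA by blast
    have kS: "continuous_map (top_of_set (S n)) X k"
      using continuous_map_from_subtopology_mono[OF ek(2) S(1)] .
    have "homeomorphic_maps (top_of_set A) X k e" using k homeomorphic_maps_sym by blast
    then have "homeomorphic_maps (subtopology (top_of_set A) (S n)) (subtopology X (k ` S n)) k e"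
      by (rule homeomorphic_maps_subtopologies) (use S(1)[of n] sub in auto)
    moreover have "subtopology (top_of_set A) (S n) = top_of_set (S n)"
      using S(1)[of n] by (simp add: subtopology_subtopology Int_absorb1)
    ultimately have "top_of_set (S n) homeomorphic_space subtopology X (k ` S n)"
      using homeomorphic_maps_imp_homeomorphic_space by metis
    then show "homogeneous_space (subtopology X (k ` S n))"
      by (rule homogeneous_space_homeomorphic[OF S(2)])
    have "analytic_in X (k ` S n)" using analytic_in_image[OF S(3) kS] .
    then have "analytic_in Z (j ` (k ` S n))"
      by (rule analytic_in_image) (rule continuous_map_from_subtopology[OF jcont])
    then show "k ` S n \<in> Sigma11 X"
      by (rule Sigma11I[OF Z(1,2)]) (use sub in blast)+
  next
    show "topspace X = (\<Union>n. k ` S n)" using kA S(4) by blast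
  qed
qed

end
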